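(* Assume $n>3t$ and a strong $(t+1)$ common coin. Algorithm A2 (described in the context) solves binary Byzantine consensus: (Agreement) no two non-faulty processes decide different values; (Validity) every value decided by a non-faulty process was proposed by a non-faulty process, in particular if all non-faulty processes propose the same value $v$ then no value other than $v$ is decided; (Termination) every non-faulty process completes every round, with probability $1$ every non-faulty process decides, and the expected number of rounds until all non-faulty processes have decided is $O(1)$ (without any fairness assumption on message scheduling).
   Context: System model: $n$ asynchronous sequential processes $p_1,\dots,p_n$, of which at most $t$ are Byzantine (behave arbitrarily, may collude); the others are non-faulty. Processes communicate over reliable asynchronous point-to-point channels between every pair: messages between non-faulty processes are eventually delivered, unaltered, not duplicated, and the receiver knows the identity of the sender; there is no bound on delays and the adversary controls delivery order. "Broadcast $m$" means sending $m$ to every process (including oneself). When counting messages "received from $k$ distinct processes", at most one message per sender is counted. S-Broadcast with tag $T$, value $v$ and Boolean $\mathit{sb}_i$ at process $p_i$: set the Boolean flag $\mathit{sval}_i\leftarrow\mathit{false}$; if $\mathit{sb}_i=\mathit{true}$, broadcast $\mathrm{SVAL}(T,v)$; return a reference to $\mathit{sval}_i$ (which may later become true). In the background (only for messages carrying this same value $v$): when $\mathrm{SVAL}(T,v)$ has been received from $t+1$ distinct processes and $p_i$ has not yet broadcast $\mathrm{SVAL}(T,v)$, $p_i$ broadcasts $\mathrm{SVAL}(T,v)$; when $\mathrm{SVAL}(T,v)$ has been received from $2t+1$ distinct processes, $p_i$ sets $\mathit{sval}_i\leftarrow\mathit{true}$. Instances with different (tag, value) pairs are independent. Strong $(t+1)$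 common coin: for each round $r$, a call $\mathsf{random}()$ in round $r$ returns the same uniformly random bit to every non-faulty caller; this bit is unpredictable and is not revealed to anyone before at least $t+1$ non-faulty processes have called $\mathsf{random}()$ in round $r$. Algorithm A2 (binary consensus), at non-faulty $p_i$ proposing $v_i\in\{0,1\}$, with a two-entry array $\mathit{ptr}[0],\mathit{ptr}[1]$ of references to Boolean flags: set $s\leftarrow\neg v_i$, $r\leftarrow0$, $\mathit{support}\leftarrow\mathit{false}$; $\mathit{ptr}[s]\leftarrow$ S-Broadcast with tag $\mathrm{EST}[1]$, value $s$, Boolean $\mathit{false}$. Repeat forever: (1) $r\leftarrow r+1$. (2) $\mathit{ptr}[\neg s]\leftarrow$ S-Broadcast with tag $\mathrm{EST}[r]$, value $\neg s$, Boolean $\neg\mathit{support}$ (the entry $\mathit{ptr}[s]$ is left unchanged, still referring to an earlier instance). (3) Wait until $\mathit{ptr}[0]=\mathit{true}$ or $\mathit{ptr}[1]=\mathit{true}$. (4) If $\mathit{support}=\mathit{true}$ then $w\leftarrow s$; else if $\mathit{ptr}[0]=\mathit{true}$ then $w\leftarrow0$; else ($\mathit{ptr}[1]=\mathit{true}$) $w\leftarrow1$. (5) Broadcast $\mathrm{AUX}(r,w)$. (6) Wait until there are $n-t$ distinct processes $p_j$ from which a message $\mathrm{AUX}(r,w_j)$ has been received with $\mathit{ptr}[w_j]=\mathit{true}$; let $\mathit{view}$ be the set of these values $w_j$. (7) $s\leftarrow\mathsf{random}()$. (8) If $\mathit{view}=\{s\}$: $\mathit{support}\leftarrow\mathit{true}$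 and decide $s$ if not yet decided; else if $\mathit{view}=\{0,1\}$: $\mathit{support}\leftarrow\mathit{true}$; else $\mathit{support}\leftarrow\mathit{false}$. ($\neg$ denotes bit negation.) *)

theory Defs
  imports "HOL-Probability.Probability"
begin

(* ------------------------------------------------------------------------
   Model of Algorithm A2 in the asynchronous Byzantine message-passing model.
   Processes p_1..p_n are represented by 0..<n.  F is the set of Byzantine
   processes.  The whole system is driven by an adversary (scheduler + Byzantine
   processes), which at each step chooses an action.  The only randomness is the
   common coin, an infinite sequence of fair bits c :: nat => bool (c r is the
   coin of round r).
   ------------------------------------------------------------------------ *)

datatype msg = SVAL nat bool   (* SVAL(EST[k], b) *)
             | AUX nat bool    (* AUX(r, w) *)

datatype phase = W3            (* waiting at step (3) *)
               | W6            (* waiting at step (6) *)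
               | WCoin "bool set"  (* has called random() at step (7), with the computed view *)

record lstate =
  rnd :: nat
  est :: bool
  supp :: bool
  ptr :: "bool \<Rightarrow> nat"         (* ptr[b] refers to the S-Broadcast instance (EST[ptr b], b) *)
  ph :: phase
  dec :: "(bool \<times> nat) option"   (* decided value and round in which it was decided *)
  invoked :: "(nat \<times> bool) set"  (* S-Broadcast instances (EST[k], b) invoked so far *)
  bcast :: "(nat \<times> bool) set"    (* instances for which SVAL(EST[k],b) has been broadcast *)
  rcvd :: "(nat \<times> msg) set"

record config =
  procs :: "nat \<Rightarrow> lstate"
  net :: "(nat \<times> nat \<times> msg) set"  (* (sender, receiver, msg) ever sent by non-faulty processes *)

datatype action =
    Deliver nat nat msg
  | Inject nat nat msg
  | Local nat "(nat \<times> bool) set"    (* local step of a process; the set is the adversary's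
                                        choice of the n-t (sender, w_j) pairs at step (6) *)

(* the adversary sees the history of configurations (newest first) and the coins
   that have been revealed so far (None = not yet revealed) *)
type_synonym adversary = "(nat \<Rightarrow> bool option) \<Rightarrow> config list \<Rightarrow> action"

definition correct :: "nat \<Rightarrow> nat set \<Rightarrow> nat \<Rightarrow> bool" where
  "correct n F i \<longleftrightarrow> i < n \<and> i \<notin> F"

definition bc :: "nat \<Rightarrow> nat \<Rightarrow> msg \<Rightarrow> (nat \<times> nat \<times> msg) set" where
  "bc n i m = {(i, j, m) | j. j < n}"

definition sval_count :: "lstate \<Rightarrow> nat \<Rightarrow> bool \<Rightarrow> nat" where
  "sval_count st k b = card {j. (j, SVAL k b) \<in> rcvd st}"

definition flag :: "nat \<Rightarrow> lstate \<Rightarrow> nat \<Rightarrow> bool \<Rightarrow> bool" where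
  "flag t st k b \<longleftrightarrow> (k, b) \<in> invoked st \<and> 2 * t + 1 \<le> sval_count st k b"

definition ptrflag :: "nat \<Rightarrow> lstate \<Rightarrow> bool \<Rightarrow> bool" where
  "ptrflag t st b \<longleftrightarrow> flag t st (ptr st b) b"

definition pending :: "nat \<Rightarrow> lstate \<Rightarrow> (nat \<times> bool) set" where
  "pending t st = {(k, b). (k, b) \<in> invoked st \<and> t + 1 \<le> sval_count st k b \<and> (k, b) \<notin> bcast st}"

definition called :: "lstate \<Rightarrow> nat \<Rightarrow> bool" where
  "called st r \<longleftrightarrow> r < rnd st \<or> (r = rnd st \<and> (\<exists>V. ph st = WCoin V))"

definition coin_ready :: "nat \<Rightarrow> nat \<Rightarrow> nat set \<Rightarrow> config \<Rightarrow> nat \<Rightarrow> bool" where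
  "coin_ready n t F cfg r \<longleftrightarrow> t + 1 \<le> card {j. correct n F j \<and> called (procs cfg j) r}"

definition revealed :: "nat \<Rightarrow> nat \<Rightarrow> nat set \<Rightarrow> config \<Rightarrow> (nat \<Rightarrow> bool) \<Rightarrow> nat \<Rightarrow> bool option" where
  "revealed n t F cfg c r = (if coin_ready n t F cfg r then Some (c r) else None)"

definition valid_view :: "nat \<Rightarrow> nat \<Rightarrow> lstate \<Rightarrow> (nat \<times> bool) set \<Rightarrow> bool" where
  "valid_view n t st Q \<longleftrightarrow> finite Q \<and> inj_on fst Q \<and> card Q = n - t \<and>
     (\<forall>(j, w) \<in> Q. (j, AUX (rnd st) w) \<in> rcvd st \<and> ptrflag t st w)"

definition main_step :: "nat \<Rightarrow> nat \<Rightarrow> nat set \<Rightarrow> (nat \<Rightarrow> bool) \<Rightarrow> nat \<Rightarrow> (nat \<times> bool) set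
    \<Rightarrow> config \<Rightarrow> lstate \<Rightarrow> (nat \<times> nat \<times> msg) set \<Rightarrow> lstate \<times> (nat \<times> nat \<times> msg) set" where
  "main_step n t F c i Q cfg st N =
    (case ph st of
       W3 \<Rightarrow>
         (if ptrflag t st False \<or> ptrflag t st True then
            (let w = (if supp st then est st else if ptrflag t st False then False else True)
             in (st\<lparr>ph := W6\<rparr>, N \<union> bc n i (AUX (rnd st) w)))
          else (st, N))
     | W6 \<Rightarrow>
         (if (\<exists>Q'. valid_view n t st Q') then
            (let Q' = (if valid_view n t st Q then Q else (SOME Q'. valid_view n t st Q'))
             in (st\<lparr>ph := WCoin (snd ` Q')\<rparr>, N))
          else (st, N))
     | WCoin V \<Rightarrow>
         (if coin_ready n t F cfg (rnd st) then
            (let r = rnd st; s = c r;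
                 sp = (if V = {s} then True else if V = {False, True} then True else False);
                 d = (if V = {s} \<and> dec st = None then Some (s, r) else dec st);
                 r' = Suc r
             in (st\<lparr>rnd := r', est := s, supp := sp, dec := d,
                    ptr := (ptr st)((\<not> s) := r'),
                    invoked := insert (r', \<not> s) (invoked st),
                    bcast := (if sp then bcast st else insert (r', \<not> s) (bcast st)),
                    ph := W3\<rparr>,
                 (if sp then N else N \<union> bc n i (SVAL r' (\<not> s)))))
          else (st, N)))"

definition local_step :: "nat \<Rightarrow> nat \<Rightarrow> nat set \<Rightarrow> (nat \<Rightarrow> bool) \<Rightarrow> nat \<Rightarrow> (nat \<times> bool) set
    \<Rightarrow> config \<Rightarrow> config" where
  "local_step n t F c i Q cfg =
    (let st0 = procs cfg i; P = pending t st0;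
         st1 = st0\<lparr>bcast := bcast st0 \<union> P\<rparr>;
         N1 = net cfg \<union> {(i, j, SVAL k b) | j k b. j < n \<and> (k, b) \<in> P};
         (st2, N2) = main_step n t F c i Q cfg st1 N1
     in cfg\<lparr>procs := (procs cfg)(i := st2), net := N2\<rparr>)"

definition receive :: "nat \<Rightarrow> nat \<Rightarrow> msg \<Rightarrow> config \<Rightarrow> config" where
  "receive j i m cfg = cfg\<lparr>procs := (procs cfg)(i := (procs cfg i)\<lparr>rcvd := insert (j, m) (rcvd (procs cfg i))\<rparr>)\<rparr>"

fun step :: "nat \<Rightarrow> nat \<Rightarrow> nat set \<Rightarrow> (nat \<Rightarrow> bool) \<Rightarrow> action \<Rightarrow> config \<Rightarrow> config" where
  "step n t F c (Deliver j i m) cfg =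
     (if correct n F j \<and> correct n F i \<and> (j, i, m) \<in> net cfg then receive j i m cfg else cfg)"
| "step n t F c (Inject j i m) cfg =
     (if j \<in> F \<and> correct n F i then receive j i m cfg else cfg)"
| "step n t F c (Local i Q) cfg =
     (if correct n F i then local_step n t F c i Q cfg else cfg)"

(* initial state of a process proposing b: after the initialisation and steps (1),(2) of round 1 *)
definition init_st :: "bool \<Rightarrow> lstate" where
  "init_st b = \<lparr>rnd = 1, est = (\<not> b), supp = False, ptr = (\<lambda>_. 1), ph = W3, dec = None,
                invoked = {(1, True), (1, False)}, bcast = {(1, b)}, rcvd = {}\<rparr>"

definition init_cfg :: "nat \<Rightarrow> nat set \<Rightarrow> (nat \<Rightarrow> bool) \<Rightarrow> config" where
  "init_cfg n F v = \<lparr>procs = (\<lambda>i. init_st (v i)),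
                     net = {(i, j, SVAL 1 (v i)) | i j. correct n F i \<and> j < n}\<rparr>"

primrec hist :: "nat \<Rightarrow> nat \<Rightarrow> nat set \<Rightarrow> (nat \<Rightarrow> bool) \<Rightarrow> adversary \<Rightarrow> (nat \<Rightarrow> bool)
    \<Rightarrow> nat \<Rightarrow> config list" where
  "hist n t F v adv c 0 = [init_cfg n F v]"
| "hist n t F v adv c (Suc k) =
     (let h = hist n t F v adv c k
      in step n t F c (adv (revealed n t F (hd h) c) h) (hd h) # h)"

definition exec :: "nat \<Rightarrow> nat \<Rightarrow> nat set \<Rightarrow> (nat \<Rightarrow> bool) \<Rightarrow> adversary \<Rightarrow> (nat \<Rightarrow> bool)
    \<Rightarrow> nat \<Rightarrow> config" where
  "exec n t F v adv c k = hd (hist n t F v adv c k)"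

definition act :: "nat \<Rightarrow> nat \<Rightarrow> nat set \<Rightarrow> (nat \<Rightarrow> bool) \<Rightarrow> adversary \<Rightarrow> (nat \<Rightarrow> bool)
    \<Rightarrow> nat \<Rightarrow> action" where
  "act n t F v adv c k = adv (revealed n t F (exec n t F v adv c k) c) (hist n t F v adv c k)"

definition fair_run :: "nat \<Rightarrow> nat \<Rightarrow> nat set \<Rightarrow> (nat \<Rightarrow> bool) \<Rightarrow> adversary \<Rightarrow> (nat \<Rightarrow> bool) \<Rightarrow> bool" where
  "fair_run n t F v adv c \<longleftrightarrow>
     (\<forall>k j i m. correct n F j \<and> correct n F i \<and> (j, i, m) \<in> net (exec n t F v adv c k) \<longrightarrow>
        (\<exists>k'. (j, m) \<in> rcvd (procs (exec n t F v adv c k') i))) \<and>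
     (\<forall>i k. correct n F i \<longrightarrow> (\<exists>k' \<ge> k. \<exists>Q. act n t F v adv c k' = Local i Q))"

definition coin_space :: "(nat \<Rightarrow> bool) measure" where
  "coin_space = PiM UNIV (\<lambda>_. measure_pmf (bernoulli_pmf (1/2)))"

(* number of rounds until all non-faulty processes have decided (\<infinity> if never) *)
definition rounds_to_decide :: "nat \<Rightarrow> nat \<Rightarrow> nat set \<Rightarrow> (nat \<Rightarrow> bool) \<Rightarrow> adversary
    \<Rightarrow> (nat \<Rightarrow> bool) \<Rightarrow> ennreal" where
  "rounds_to_decide n t F v adv c =
     (INF r \<in> {r. \<exists>k. \<forall>i. correct n F i \<longrightarrow>
                  (\<exists>a r'. dec (procs (exec n t F v adv c k) i) = Some (a, r') \<and> r' \<le> r)}. of_nat r)"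

definition valid_system :: "nat \<Rightarrow> nat \<Rightarrow> nat set \<Rightarrow> bool" where
  "valid_system n t F \<longleftrightarrow> 3 * t < n \<and> F \<subseteq> {..<n} \<and> card F \<le> t"

end

theory Submission
  imports Defs
begin

text \<open>
  All non-faulty processes use the same pointers in a given round, because these depend on the
  earlier coins only. Two views of the same round are computed from \<open>n - t\<close> messages each, so a
  singleton view \<open>{w}\<close> forces \<open>w\<close> into every other view of that round. If the coin \<open>s\<close> lies in
  every view of a round, then every non-faulty process enters the next round in support of \<open>s\<close>,
  nobody starts the new S-Broadcast instance for the opposite value, and from then on every view
  is \<open>{s}\<close>. This gives agreement and validity.

  When the coin of round \<open>r\<close> is revealed, \<open>t + 1\<close> non-faulty processes have fixed their views.
  If one of these is a singleton \<open>{w}\<close>, a coin equal to \<open>w\<close> lies in every view of round \<open>r\<close>.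
  Otherwise all \<open>t + 1\<close> of them support the coin \<open>s\<close> of round \<open>r\<close> whatever it is; their messages
  reach every quorum of round \<open>r + 1\<close>, so \<open>s\<close> lies in every view of round \<open>r + 1\<close>. Hence one
  favourable value of the coin of round \<open>r\<close>, repeated in rounds \<open>r + 1\<close> and \<open>r + 2\<close>, makes
  everybody decide by round \<open>r + 2\<close>. This value is determined by the coins of the rounds before
  \<open>r\<close>, so each block of three rounds succeeds with probability \<open>1/8\<close> independently of the past,
  and the expected number of rounds is at most \<open>3 * 8 = 24\<close>.
\<close>

subsection \<open>Steps of an execution\<close>

text \<open>The pointers of every non-faulty process in round \<open>r\<close>; round 0 does not exist.\<close>
primrec ptrs :: "(nat \<Rightarrow> bool) \<Rightarrow> nat \<Rightarrow> bool \<Rightarrow> nat" where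
  "ptrs c 0 = (\<lambda>_. 1)"
| "ptrs c (Suc r) = (if r = 0 then (\<lambda>_. 1) else (ptrs c r)(\<not> c r := Suc r))"

text \<open>These are the instances invoked up to round \<open>r\<close>: both values in round 1,
  and afterwards, on entering round \<open>q + 1\<close>, only the value opposite to the coin of
  round \<open>q\<close>. Like the pointers, they depend on the coins alone.\<close>

definition insts :: "(nat \<Rightarrow> bool) \<Rightarrow> nat \<Rightarrow> (nat \<times> bool) set" where
  "insts c r = {(1, b) | b. True} \<union> {(Suc q, \<not> c q) | q. 1 \<le> q \<and> q < r}"

lemma insts_mono: "r \<le> r' \<Longrightarrow> insts c r \<subseteq> insts c r'"
  by (auto simp: insts_def)

lemma ptrs_Suc: "1 \<le> r \<Longrightarrow> ptrs c (Suc r) b = (if b = c r then ptrs c r b else Suc r)"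
  by auto

lemma ptrs_in_insts: "1 \<le> r \<Longrightarrow> (ptrs c r b, b) \<in> insts c r"
proof (induction r)
  case (Suc r)
  show ?case
  proof (cases "r = 0 \<or> b \<noteq> c r")
    case False
    then show ?thesis using Suc insts_mono[of r "Suc r" c] by (auto simp: ptrs_Suc simp del: ptrs.simps)
  qed (auto simp: insts_def)
qed simp

text \<open>Position in the code as a single number: the three phases of round \<open>r\<close>
  occupy \<open>3 * r\<close>, \<open>3 * r + 1\<close> and \<open>3 * r + 2\<close>. Each
  successful main step raises it by exactly one, so statements about rounds and phases become
  inequalities.\<close>

definition prog :: "lstate \<Rightarrow> nat" where
  "prog s = 3 * rnd s + (case ph s of W3 \<Rightarrow> 0 | W6 \<Rightarrow> 1 | WCoin V \<Rightarrow> 2)"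

lemma called_iff_prog: "called s r \<longleftrightarrow> 3 * r + 2 \<le> prog s"
  by (auto simp: called_def prog_def split: phase.splits)

lemma net_local_step:
  "net cfg \<subseteq> net (local_step n t F c i Q cfg)"
  "net (local_step n t F c i Q cfg) \<subseteq> net cfg \<union> {i} \<times> UNIV"
proof -
  have main: "N \<subseteq> snd (main_step n t F c i Q cfg s N) \<and>
      snd (main_step n t F c i Q cfg s N) \<subseteq> N \<union> {i} \<times> UNIV" for s N
    by (auto simp: main_step_def Let_def bc_def split: phase.split)
  define s1 where "s1 = (procs cfg i)\<lparr>bcast := bcast (procs cfg i) \<union> pending t (procs cfg i)\<rparr>"
  define N1 where "N1 = net cfg \<union> {(i, j, SVAL q b) | j q b. j < n \<and> (q, b) \<in> pending t (procs cfg i)}"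
  have "net (local_step n t F c i Q cfg) = snd (main_step n t F c i Q cfg s1 N1)"
    by (simp add: local_step_def Let_def case_prod_beta s1_def N1_def)
  moreover have "net cfg \<subseteq> N1" "N1 \<subseteq> net cfg \<union> {i} \<times> UNIV"
    by (auto simp: N1_def)
  ultimately show "net cfg \<subseteq> net (local_step n t F c i Q cfg)"
    "net (local_step n t F c i Q cfg) \<subseteq> net cfg \<union> {i} \<times> UNIV"
    using main[of N1 s1] by auto
qed

text \<open>The adversary is forgotten here: an arbitrary sequence of actions under a fixed sequence
  of coins is enough for the safety properties.\<close>

locale run =
  fixes n t :: nat and F :: "nat set" and v c :: "nat \<Rightarrow> bool"
    and X :: "nat \<Rightarrow> config" and a :: "nat \<Rightarrow> action"
  assumes valid: "valid_system n t F"
    and X_0: "X 0 = init_cfg n F v"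
    and X_Suc: "X (Suc k) = step n t F c (a k) (X k)"
begin

abbreviation state :: "nat \<Rightarrow> nat \<Rightarrow> lstate" where
  "state k i \<equiv> procs (X k) i"

abbreviation cor :: "nat \<Rightarrow> bool" where
  "cor i \<equiv> correct n F i"

text \<open>One global step as seen by process \<open>i\<close>. A local step first echoes the
  pending instances and then tries the main step; echoing changes neither flags nor valid views, so
  all guards refer to the state before the step. The disjunction in \<open>same\<close> allows this
  case to be excluded when \<open>i\<close> has just sent something new.\<close>

lemma state_Suc_cases [case_names same recv echo w3 w6 coin]:
  assumes "(\<forall>Q. a k \<noteq> Local i Q) \<or> net (X (Suc k)) = net (X k) \<Longrightarrow>
      state (Suc k) i = state k i \<Longrightarrow> P"
    and "\<And>j m. cor i \<Longrightarrow> \<forall>Q. a k \<noteq> Local i Q \<Longrightarrow> cor j \<and> (j, i, m) \<in> net (X k) \<or> j \<in> F \<Longrightarrow>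
      state (Suc k) i = (state k i)\<lparr>rcvd := insert (j, m) (rcvd (state k i))\<rparr> \<Longrightarrow> P"
    and "cor i \<Longrightarrow> state (Suc k) i =
      (state k i)\<lparr>bcast := bcast (state k i) \<union> pending t (state k i)\<rparr> \<Longrightarrow>
      net (X (Suc k)) = net (X k) \<union>
        {(i, j, SVAL q b) | j q b. j < n \<and> (q, b) \<in> pending t (state k i)} \<Longrightarrow> P"
    and "\<And>w. cor i \<Longrightarrow> ph (state k i) = W3 \<Longrightarrow>
      w = (if supp (state k i) then est (state k i)
           else if ptrflag t (state k i) False then False else True) \<Longrightarrow>
      ptrflag t (state k i) False \<or> ptrflag t (state k i) True \<Longrightarrow>
      state (Suc k) i =
        (state k i)\<lparr>bcast := bcast (state k i) \<union> pending t (state k i), ph := W6\<rparr> \<Longrightarrow>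
      net (X (Suc k)) = net (X k) \<union>
        {(i, j, SVAL q b) | j q b. j < n \<and> (q, b) \<in> pending t (state k i)} \<union>
        bc n i (AUX (rnd (state k i)) w) \<Longrightarrow> P"
    and "\<And>Q. cor i \<Longrightarrow> ph (state k i) = W6 \<Longrightarrow> valid_view n t (state k i) Q \<Longrightarrow>
      state (Suc k) i = (state k i)\<lparr>bcast := bcast (state k i) \<union> pending t (state k i),
        ph := WCoin (snd ` Q)\<rparr> \<Longrightarrow>
      net (X (Suc k)) = net (X k) \<union>
        {(i, j, SVAL q b) | j q b. j < n \<and> (q, b) \<in> pending t (state k i)} \<Longrightarrow> P"
    and "\<And>V r. cor i \<Longrightarrow> ph (state k i) = WCoin V \<Longrightarrow> r = rnd (state k i) \<Longrightarrow>
      coin_ready n t F (X k) r \<Longrightarrow>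
      state (Suc k) i = (state k i)\<lparr>rnd := Suc r, est := c r,
        supp := (V = {c r} \<or> V = {False, True}),
        dec := (if V = {c r} \<and> dec (state k i) = None then Some (c r, r) else dec (state k i)),
        ptr := (ptr (state k i))((\<not> c r) := Suc r),
        invoked := insert (Suc r, \<not> c r) (invoked (state k i)),
        bcast := (if V = {c r} \<or> V = {False, True}
          then bcast (state k i) \<union> pending t (state k i)
          else insert (Suc r, \<not> c r) (bcast (state k i) \<union> pending t (state k i))),
        ph := W3\<rparr> \<Longrightarrow>
      net (X (Suc k)) = net (X k) \<union>
        {(i, j, SVAL q b) | j q b. j < n \<and> (q, b) \<in> pending t (state k i)} \<union>
        (if V = {c r} \<or> V = {False, True} then {} else bc n i (SVAL (Suc r) (\<not> c r))) \<Longrightarrow> P"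
  shows P
proof (cases "a k")
  case (Deliver j i' m)
  then have "state (Suc k) i = state k i \<or> cor i \<and> (cor j \<and> (j, i, m) \<in> net (X k) \<or> j \<in> F) \<and>
      state (Suc k) i = (state k i)\<lparr>rcvd := insert (j, m) (rcvd (state k i))\<rparr>"
    using X_Suc[of k] by (simp add: receive_def)
  moreover have "\<forall>Q. a k \<noteq> Local i Q"
    using Deliver by simp
  ultimately show ?thesis
    by (elim disjE conjE) (blast intro: assms(1,2))+
next
  case (Inject j i' m)
  then have "state (Suc k) i = state k i \<or> cor i \<and> (cor j \<and> (j, i, m) \<in> net (X k) \<or> j \<in> F) \<and>
      state (Suc k) i = (state k i)\<lparr>rcvd := insert (j, m) (rcvd (state k i))\<rparr>"
    using X_Suc[of k] by (simp add: receive_def)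
  moreover have "\<forall>Q. a k \<noteq> Local i Q"
    using Inject by simp
  ultimately show ?thesis
    by (elim disjE conjE) (blast intro: assms(1,2))+
next
  case (Local i' Q)
  show ?thesis
  proof (cases "i' = i \<and> cor i")
    case False
    with Local show ?thesis using assms(1) X_Suc[of k]
      by (cases "i' = i") (auto simp: local_step_def Let_def split: if_splits prod.splits)
  next
    case True
    define s1 where "s1 = (state k i)\<lparr>bcast := bcast (state k i) \<union> pending t (state k i)\<rparr>"
    have pf: "ptrflag t s1 b = ptrflag t (state k i) b" for b
      by (simp add: s1_def ptrflag_def flag_def sval_count_def)
    have vv: "valid_view n t s1 Q = valid_view n t (state k i) Q" for Q
      unfolding valid_view_def pf by (simp add: s1_def)
    define N1 where "N1 = net (X k) \<union>
      {(i, j, SVAL q b) | j q b. j < n \<and> (q, b) \<in> pending t (state k i)}"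
    obtain s2 N2 where ms: "main_step n t F c i Q (X k) s1 N1 = (s2, N2)"
      by fastforce
    have X: "state (Suc k) i = s2" "net (X (Suc k)) = N2"
      using X_Suc[of k] Local True ms by (auto simp: local_step_def s1_def N1_def)
    have echo: ?thesis if "s2 = s1" "N2 = N1"
      by (rule assms(3)) (use True X that in \<open>simp_all add: s1_def N1_def\<close>)
    note ms = ms[unfolded main_step_def]
    show ?thesis
    proof (cases "ph s1")
      case W3
      show ?thesis
      proof (cases "ptrflag t s1 False \<or> ptrflag t s1 True")
        case t: True
        define w where "w = (if supp s1 then est s1 else if ptrflag t s1 False then False else True)"
        have "s2 = s1\<lparr>ph := W6\<rparr>" "N2 = N1 \<union> bc n i (AUX (rnd s1) w)"
          using ms W3 t by (simp_all only: phase.case if_True Let_def w_def prod.inject)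
        then show ?thesis
          using True W3 X t pf
          by (intro assms(4)[of w]) (simp_all add: s1_def N1_def w_def)
      next
        case False
        then show ?thesis using ms W3 by (intro echo) simp_all
      qed
    next
      case W6
      show ?thesis
      proof (cases "\<exists>Q. valid_view n t s1 Q")
        case t: True
        define Q' where "Q' = (if valid_view n t s1 Q then Q else (SOME Q'. valid_view n t s1 Q'))"
        have Q': "valid_view n t s1 Q'"
          unfolding Q'_def using t by (auto intro: someI_ex)
        have "s2 = s1\<lparr>ph := WCoin (snd ` Q')\<rparr>" "N2 = N1"
          using ms W6 t by (simp_all only: phase.case if_True Let_def Q'_def prod.inject)
        then show ?thesis
          using True W6 Q' X vv
          by (intro assms(5)[of Q']) (simp_all add: s1_def N1_def)
      next
        case False
        then show ?thesis using ms W6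
          by (intro echo) (simp_all only: phase.case if_False prod.inject)
      qed
    next
      case (WCoin V)
      show ?thesis
      proof (cases "coin_ready n t F (X k) (rnd s1)")
        case t: True
        define r where "r = rnd s1"
        define sp where "sp \<longleftrightarrow> V = {c r} \<or> V = {False, True}"
        have sp: "(if V = {c r} then True else if V = {False, True} then True else False) = sp"
          by (simp add: sp_def)
        have "s2 = s1\<lparr>rnd := Suc r, est := c r, supp := sp,
            dec := (if V = {c r} \<and> dec s1 = None then Some (c r, r) else dec s1),
            ptr := (ptr s1)((\<not> c r) := Suc r),
            invoked := insert (Suc r, \<not> c r) (invoked s1),
            bcast := (if sp then bcast s1 else insert (Suc r, \<not> c r) (bcast s1)),
            ph := W3\<rparr>"
          "N2 = (if sp then N1 else N1 \<union> bc n i (SVAL (Suc r) (\<not> c r)))"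
          using ms WCoin t
          by (simp_all only: phase.case if_True Let_def prod.inject r_def [symmetric] sp)
        then show ?thesis
          using True WCoin t X
          by (intro assms(6)[of V r]) (simp_all add: s1_def N1_def r_def sp_def)
      next
        case False
        then show ?thesis using ms WCoin by (intro echo) simp_all
      qed
    qed
  qed
qed

text \<open>Only a local step of \<open>j\<close> itself adds messages sent by \<open>j\<close>, and
  it does so as an echo, as an \<open>AUX\<close> message on leaving step (3), or by entering a
  round without support.\<close>

lemma net_Suc_cases [consumes 1, case_names old echo aux coin]:
  assumes "(j, i, m) \<in> net (X (Suc k))"
    and "(j, i, m) \<in> net (X k) \<Longrightarrow> P"
    and "\<And>q b. m = SVAL q b \<Longrightarrow> (q, b) \<in> pending t (state k j) \<Longrightarrow> i < n \<Longrightarrow> cor j \<Longrightarrow>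
       \<forall>i<n. (j, i, m) \<in> net (X (Suc k)) \<Longrightarrow> P"
    and "\<And>w. m = AUX (rnd (state k j)) w \<Longrightarrow> i < n \<Longrightarrow> cor j \<Longrightarrow>
       ph (state k j) = W3 \<Longrightarrow> ph (state (Suc k) j) = W6 \<Longrightarrow>
       rnd (state (Suc k) j) = rnd (state k j) \<Longrightarrow>
       w = (if supp (state k j) then est (state k j)
            else if ptrflag t (state k j) False then False else True) \<Longrightarrow>
       ptrflag t (state k j) False \<or> ptrflag t (state k j) True \<Longrightarrow>
       \<forall>i<n. (j, i, m) \<in> net (X (Suc k)) \<Longrightarrow> P"
    and "\<And>V r. m = SVAL (Suc r) (\<not> c r) \<Longrightarrow> i < n \<Longrightarrow> cor j \<Longrightarrow>
       ph (state k j) = WCoin V \<Longrightarrow> r = rnd (state k j) \<Longrightarrow> V \<noteq> {c r} \<Longrightarrow> V \<noteq> {False, True} \<Longrightarrow>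
       \<forall>i<n. (j, i, m) \<in> net (X (Suc k)) \<Longrightarrow> P"
  shows P
proof (cases "\<exists>Q. a k = Local j Q")
  case False
  have "(j, i, m) \<in> net (X k)"
  proof (cases "a k")
    case (Local i' Q)
    then have "i' \<noteq> j" using False by auto
    then show ?thesis
      using assms(1) X_Suc[of k] Local net_local_step(2)[of n t F c i' Q "X k"]
      by (auto split: if_splits)
  qed (use assms(1) X_Suc[of k] in \<open>auto simp: receive_def split: if_splits\<close>)
  then show ?thesis by (rule assms(2))
next
  case True
  show ?thesis
  proof (cases "(j, i, m) \<in> net (X k)")
    case False
    with assms(1) have neq: "net (X (Suc k)) \<noteq> net (X k)" by auto
    show ?thesis
    proof (cases rule: state_Suc_cases[of k j])
      case same
      then show ?thesis using True neq by auto
    next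
      case (recv j m)
      then show ?thesis using True by auto
    next
      case echo
      then show ?thesis using False assms(1,3) by auto
    next
      case (w3 w)
      show ?thesis using False assms(1,3) assms(4)[of w] w3 by (auto simp: bc_def)
    next
      case (w6 Q)
      then show ?thesis using False assms(1,3) by auto
    next
      case (coin V r)
      then show ?thesis using False assms(1,3) assms(5)[of r V] by (auto simp: bc_def split: if_splits)
    qed
  qed (rule assms(2))
qed

section \<open>Counting bounds, monotonicity and invariants along an execution\<close>

lemma F_less: "j \<in> F \<Longrightarrow> j < n" and card_F: "card F \<le> t" and n_gt: "3 * t < n"
  and finite_F: "finite F"
  using valid by (auto simp: valid_system_def intro: finite_subset)

lemma cor_less: "cor j \<Longrightarrow> j < n"
  by (simp add: correct_def)

lemma finite_cor: "finite {j. cor j}"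
  by (rule finite_subset[of _ "{..<n}"]) (auto simp: correct_def)

lemma card_cor: "n - t \<le> card {j. cor j}"
proof -
  have "{j. cor j} = {..<n} - F" by (auto simp: correct_def)
  then have "card {j. cor j} = n - card F"
    using finite_F F_less by (simp add: card_Diff_subset subset_iff)
  then show ?thesis using card_F by simp
qed

lemma X_0_simps [simp]: "state 0 i = init_st (v i)"
  "net (X 0) = {(i, j, SVAL 1 (v i)) | i j. cor i \<and> j < n}"
  by (simp_all add: X_0 init_cfg_def)

lemma prog_Suc: "prog (state k i) \<le> prog (state (Suc k) i)"
  by (cases rule: state_Suc_cases[of k i]) (simp_all add: prog_def)

lemma prog_mono: "k \<le> k' \<Longrightarrow> prog (state k i) \<le> prog (state k' i)"
  by (rule lift_Suc_mono_le[of "\<lambda>k. prog (state k i)"]) (simp_all add: prog_Suc)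

lemma rnd_prog: "3 * rnd s \<le> prog s" "prog s < 3 * rnd s + 3"
  by (auto simp: prog_def split: phase.split)

lemma rcvd_Suc: "rcvd (state k i) \<subseteq> rcvd (state (Suc k) i)"
  by (cases rule: state_Suc_cases[of k i]) auto

lemma rcvd_mono: "k \<le> k' \<Longrightarrow> rcvd (state k i) \<subseteq> rcvd (state k' i)"
  by (rule lift_Suc_mono_le[of "\<lambda>k. rcvd (state k i)"]) (simp_all add: rcvd_Suc)

lemma net_Suc: "net (X k) \<subseteq> net (X (Suc k))"
  using net_local_step(1) by (cases "a k") (auto simp: X_Suc receive_def)

lemma net_mono: "k \<le> k' \<Longrightarrow> net (X k) \<subseteq> net (X k')"
  by (rule lift_Suc_mono_le[of "\<lambda>k. net (X k)"]) (simp_all add: net_Suc)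

text \<open>The updates at the end of a round use the common coin only, so pointers, invoked
  instances and estimate are functions of the round number. In round 1 the estimate still comes from
  the proposal, hence the guard \<open>1 < rnd\<close>.\<close>

lemma state_inv:
  "1 \<le> rnd (state k i) \<and> ptr (state k i) = ptrs c (rnd (state k i)) \<and>
   invoked (state k i) = insts c (rnd (state k i)) \<and>
   (1 < rnd (state k i) \<longrightarrow> est (state k i) = c (rnd (state k i) - 1))"
proof (induction k)
  case 0
  show ?case by (auto simp: init_st_def insts_def)
next
  case (Suc k)
  then show ?case
  proof (cases rule: state_Suc_cases[of k i])
    case (coin V r)
    then show ?thesis using Suc by (auto simp: insts_def less_Suc_eq fun_eq_iff)
  qed simp_all
qed

lemma rnd_mono: "k \<le> k' \<Longrightarrow> rnd (state k i) \<le> rnd (state k' i)"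
  using prog_mono[of k k' i] rnd_prog[of "state k i"] rnd_prog[of "state k' i"] by simp

lemma invoked_mono: "k \<le> k' \<Longrightarrow> invoked (state k i) \<subseteq> invoked (state k' i)"
  using state_inv insts_mono rnd_mono by metis

lemma net_broadcast:
  "(j, i, m) \<in> net (X k) \<Longrightarrow> cor j \<and> i < n \<and> (\<forall>i'<n. (j, i', m) \<in> net (X k))"
proof (induction k)
  case 0
  then show ?case by auto
next
  case (Suc k)
  from Suc.prems show ?case
    by (cases rule: net_Suc_cases) (use Suc.IH net_Suc[of k] in blast)+
qed

lemma rcvd_origin: "(j, m) \<in> rcvd (state k i) \<Longrightarrow> j < n \<and> (j \<notin> F \<longrightarrow> (j, i, m) \<in> net (X k))"
proof (induction k)
  case 0
  then show ?case by (simp add: init_st_def)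
next
  case (Suc k)
  have mono: "(j, i, m) \<in> net (X k) \<Longrightarrow> (j, i, m) \<in> net (X (Suc k))"
    using net_Suc[of k] by blast
  show ?case
  proof (cases rule: state_Suc_cases[of k i])
    case (recv j' m')
    then show ?thesis using Suc mono F_less
      by (auto simp: correct_def)
  qed (use Suc mono in auto)
qed

lemma finite_svals: "finite {j. (j, SVAL q b) \<in> rcvd (state k i)}"
  by (rule finite_subset[of _ "{..<n}"]) (use rcvd_origin in auto)

lemma sval_count_mono: "k \<le> k' \<Longrightarrow> sval_count (state k i) q b \<le> sval_count (state k' i) q b"
  unfolding sval_count_def using rcvd_mono by (intro card_mono finite_svals) auto

lemma flag_mono: "k \<le> k' \<Longrightarrow> flag t (state k i) q b \<Longrightarrow> flag t (state k' i) q b"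
  unfolding flag_def using sval_count_mono invoked_mono by (meson order_trans subsetD)

lemma correct_in_large_set:
  assumes "A \<subseteq> {..<n}" "t + 1 \<le> card A"
  shows "\<exists>j\<in>A. cor j"
proof (rule ccontr)
  assume "\<not> ?thesis"
  with assms(1) have "A \<subseteq> F" by (auto simp: correct_def)
  then have "card A \<le> card F" using finite_F by (rule card_mono[rotated])
  then show False using assms(2) card_F by simp
qed

subsection \<open>Agreement and validity\<close>

definition viewed :: "nat \<Rightarrow> nat \<Rightarrow> bool set \<Rightarrow> bool" where
  "viewed i r V \<longleftrightarrow> (\<exists>k. rnd (state k i) = r \<and> ph (state k i) = WCoin V)"

lemma view_persists:
  assumes "ph (state k i) = WCoin V" "rnd (state k i) = r"
  shows "3 * r + 3 \<le> prog (state (k + d) i) \<or>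
    rnd (state (k + d) i) = r \<and> ph (state (k + d) i) = WCoin V"
proof (induction d)
  case (Suc d)
  then show ?case
  proof
    assume "3 * r + 3 \<le> prog (state (k + d) i)"
    then show ?thesis using prog_Suc[of "k + d" i] by simp
  next
    assume "rnd (state (k + d) i) = r \<and> ph (state (k + d) i) = WCoin V"
    then show ?thesis
      by (cases rule: state_Suc_cases[of "k + d" i]) (auto simp: prog_def)
  qed
qed (use assms in simp)

lemma viewed_unique:
  assumes "viewed i r V" "viewed i r V'"
  shows "V = V'"
proof -
  have *: "V1 = V2" if "k \<le> k'" "ph (state k i) = WCoin V1" "rnd (state k i) = r"
    "ph (state k' i) = WCoin V2" "rnd (state k' i) = r" for k k' V1 V2
    using view_persists[of k i V1 r "k' - k"] that by (auto simp: prog_def)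
  obtain k k' where "ph (state k i) = WCoin V" "rnd (state k i) = r"
    "ph (state k' i) = WCoin V'" "rnd (state k' i) = r"
    using assms by (auto simp: viewed_def)
  then show ?thesis using *[of k k' V V'] *[of k' k V' V] by (metis nle_le)
qed

text \<open>The position grows by at most one per step, so it cannot pass \<open>3 * r + 2\<close>
  without the process computing a view in round \<open>r\<close>.\<close>

lemma viewed_exists:
  assumes "3 * r + 2 \<le> prog (state k i)" "1 \<le> r"
  shows "\<exists>V. viewed i r V"
  using assms(1)
proof (induction k)
  case 0
  then show ?case using assms by (simp add: prog_def init_st_def)
next
  case (Suc k)
  show ?case
  proof (cases "3 * r + 2 \<le> prog (state k i)")
    case False
    show ?thesis
    proof (cases rule: state_Suc_cases[of k i])
      case (w3 w)
      then have "prog (state k i) = 3 * rnd (state k i)" "prog (state (Suc k) i) = 3 * rnd (state k i) + 1"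
        by (simp_all add: prog_def)
      then show ?thesis using False Suc.prems by presburger
    next
      case (w6 Q)
      then have "prog (state k i) = 3 * rnd (state k i) + 1" "prog (state (Suc k) i) = 3 * rnd (state k i) + 2"
        by (simp_all add: prog_def)
      then have "rnd (state (Suc k) i) = r" using w6 False Suc.prems by simp
      then show ?thesis using w6 by (auto simp: viewed_def intro!: exI[of _ "Suc k"])
    next
      case (coin V r)
      then have "prog (state k i) = 3 * rnd (state k i) + 2" "prog (state (Suc k) i) = 3 * rnd (state k i) + 3"
        by (simp_all add: prog_def)
      then show ?thesis using False Suc.prems by presburger
    qed (use False Suc.prems in \<open>simp_all add: prog_def\<close>)
  qed (use Suc in auto)
qed

lemma viewed_cor: "viewed i r V \<Longrightarrow> cor i"
proof -
  have "ph (state k i) \<noteq> WCoin V" if "\<not> cor i" for k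
  proof (induction k)
    case (Suc k)
    then show ?case using that by (cases rule: state_Suc_cases[of k i]) auto
  qed (simp add: init_st_def)
  then show "viewed i r V \<Longrightarrow> cor i" by (auto simp: viewed_def)
qed

lemma viewed_rnd: "viewed i r V \<Longrightarrow> 1 \<le> r"
  using state_inv by (auto simp: viewed_def)

text \<open>This is \<open>valid_view\<close> with the round and the pointers made explicit, so that
  it does not refer to the current round of \<open>i\<close>.\<close>

definition quorum :: "nat \<Rightarrow> nat \<Rightarrow> nat \<Rightarrow> (nat \<times> bool) set \<Rightarrow> bool" where
  "quorum k i r Q \<longleftrightarrow> finite Q \<and> inj_on fst Q \<and> card Q = n - t \<and>
     (\<forall>(j, w)\<in>Q. (j, AUX r w) \<in> rcvd (state k i) \<and> flag t (state k i) (ptrs c r w) w)"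

lemma viewed_quorum:
  assumes "viewed i r V"
  shows "\<exists>k Q. quorum k i r Q \<and> V = snd ` Q"
proof -
  have "\<exists>k Q. quorum k i r Q \<and> V = snd ` Q"
    if "ph (state k i) = WCoin V" "rnd (state k i) = r" for k
    using that
  proof (induction k)
    case 0
    then show ?case by (simp add: init_st_def)
  next
    case (Suc k)
    show ?case
    proof (cases rule: state_Suc_cases[of k i])
      case (w6 Q)
      then have "quorum k i r Q" "V = snd ` Q"
        using Suc.prems state_inv[of k i]
        by (auto simp: valid_view_def quorum_def ptrflag_def)
      then show ?thesis by blast
    qed (use Suc in auto)
  qed
  then show ?thesis using assms by (auto simp: viewed_def)
qed

lemma quorum_senders:
  assumes "quorum k i r Q"
  shows "fst ` Q \<subseteq> {..<n}" "card (fst ` Q) = n - t"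
    "\<And>j. cor j \<Longrightarrow> j \<in> fst ` Q \<Longrightarrow> \<exists>w. (j, w) \<in> Q \<and> (j, i, AUX r w) \<in> net (X k)"
  using assms rcvd_origin unfolding quorum_def
  by (fastforce simp: card_image correct_def)+

lemma viewed_nonempty: "viewed i r V \<Longrightarrow> V \<noteq> {}"
  using viewed_quorum[of i r V] n_gt by (auto simp: quorum_def)

lemma viewed_flag: "viewed i r V \<Longrightarrow> w \<in> V \<Longrightarrow> \<exists>k. flag t (state k i) (ptrs c r w) w"
  using viewed_quorum[of i r V] by (fastforce simp: quorum_def)

text \<open>Views are nonempty sets of bits, so the two cases of step (8) that set
  \<open>support\<close> are together exactly the views containing the coin.\<close>

lemma supp_inv:
  "(rnd (state k i) = 1 \<longrightarrow> \<not> supp (state k i)) \<and>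
   (\<forall>r V. rnd (state k i) = Suc r \<and> viewed i r V \<longrightarrow> (supp (state k i) \<longleftrightarrow> c r \<in> V))"
proof (induction k)
  case 0
  show ?case using viewed_rnd by (fastforce simp: init_st_def)
next
  case (Suc k)
  show ?case
  proof (cases rule: state_Suc_cases[of k i])
    case (coin V r)
    have "viewed i r V" using coin by (auto simp: viewed_def)
    then have V: "viewed i r V' \<Longrightarrow> V' = V" for V' using viewed_unique by blast
    have "V = {c r} \<or> V = {False, True} \<longleftrightarrow> c r \<in> V"
      using viewed_nonempty[OF \<open>viewed i r V\<close>] by (cases "c r"; auto; metis (full_types))
    then show ?thesis using coin V state_inv[of k i] by auto
  qed (use Suc in auto)
qed

lemma aux_rnd: "(j, i, AUX r w) \<in> net (X k) \<Longrightarrow> 1 \<le> r \<and> 3 * r + 1 \<le> prog (state k j)"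
proof (induction k)
  case (Suc k)
  from Suc.prems show ?case
  proof (cases rule: net_Suc_cases)
    case old
    then show ?thesis using Suc.IH prog_Suc[of k j] by simp
  next
    case (aux w')
    then show ?thesis using state_inv[of k j] by (simp add: prog_def)
  qed auto
qed simp

text \<open>A process that has sent \<open>AUX\<close> for round \<open>r\<close> is past position
  \<open>3 * r\<close> and never waits at step (3) of that round again, so it sends one value per
  round.\<close>

lemma aux_inj:
  "(j, i, AUX r w) \<in> net (X k) \<Longrightarrow> (j, i', AUX r w') \<in> net (X k) \<Longrightarrow> w = w'"
proof (induction k)
  case (Suc k)
  have old: "ph (state k j) \<noteq> W3 \<or> rnd (state k j) \<noteq> r" if "(j, i, AUX r w) \<in> net (X k)" for i w
    using aux_rnd[OF that] by (auto simp: prog_def)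
  from Suc.prems(1) show ?case
  proof (cases rule: net_Suc_cases)
    case old1: old
    from Suc.prems(2) show ?thesis
      by (cases rule: net_Suc_cases) (use old[OF old1] Suc.IH old1 in auto)
  next
    case (aux w1)
    from Suc.prems(2) show ?thesis
      by (cases rule: net_Suc_cases) (use old aux in auto)
  qed auto
qed simp

lemma aux_inj':
  assumes "(j, i, AUX r w) \<in> net (X k)" "(j, i', AUX r w') \<in> net (X k')"
  shows "w = w'"
  using aux_inj[of j i r w "max k k'" i' w'] assms net_mono[of k "max k k'"] net_mono[of k' "max k k'"]
  by auto

text \<open>The first part says that supporters send the previous coin. The second part is what
  makes the message usable by its receivers: the value sent has a raised flag at its sender, either
  because step (3) tested it or, for a supporter, because the value was in its previous
  view.\<close>

lemma aux_value:
  assumes "(j, i, AUX r w) \<in> net (X k)"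
  shows "(\<forall>r' V. r = Suc r' \<and> viewed j r' V \<and> c r' \<in> V \<longrightarrow> w = c r') \<and>
    (\<exists>k. flag t (state k j) (ptrs c r w) w)"
  using assms
proof (induction k)
  case (Suc k)
  from Suc.prems show ?case
  proof (cases rule: net_Suc_cases)
    case (aux w')
    show ?thesis
    proof (cases "supp (state k j)")
      case False
      then show ?thesis
        using supp_inv[of k j] aux state_inv[of k j] by (auto simp: ptrflag_def)
    next
      case True
      then have "rnd (state k j) \<noteq> 1" using supp_inv[of k j] by simp
      with state_inv[of k j] obtain r' where r': "rnd (state k j) = Suc r'" "1 \<le> r'"
        by (cases "rnd (state k j)") auto
      have "3 * r' + 2 \<le> prog (state k j)" using r' by (simp add: prog_def)
      then obtain V where V: "viewed j r' V" using viewed_exists r' by blast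
      then have "c r' \<in> V" using supp_inv[of k j] True r' by blast
      moreover have "w = c r'" using aux True state_inv[of k j] r' by simp
      moreover have "ptrs c r w = ptrs c r' w" using \<open>w = c r'\<close> aux r' by simp
      ultimately show ?thesis
        using viewed_flag[OF V, of w] aux r' by auto
    qed
  qed (use Suc.IH in auto)
qed simp

section \<open>Origin of S-Broadcast messages and locked values\<close>

definition starts :: "nat \<Rightarrow> nat \<Rightarrow> bool \<Rightarrow> bool" where
  "starts j q b \<longleftrightarrow> cor j \<and> (q = 1 \<and> v j = b \<or>
     (\<exists>r V. 1 \<le> r \<and> q = Suc r \<and> b = (\<not> c r) \<and> viewed j r V \<and> c r \<notin> V))"

lemma sval_count_origin:
  assumes "t + 1 \<le> sval_count (state k i) q b"
  shows "\<exists>j. cor j \<and> (j, i, SVAL q b) \<in> net (X k)"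
  using correct_in_large_set[of "{j. (j, SVAL q b) \<in> rcvd (state k i)}"] rcvd_origin assms
  by (fastforce simp: sval_count_def correct_def)

text \<open>\<open>starts\<close> describes a broadcast made unprompted: by proposing, or by
  entering a round without support, which means that the coin is missing from the view. Every other
  \<open>SVAL\<close> is an echo of \<open>t + 1\<close> messages, one of them sent earlier by a
  non-faulty process; tracing back ends at a process that starts the instance.\<close>

lemma sval_starts: "(j, i, SVAL q b) \<in> net (X k) \<Longrightarrow> \<exists>j. starts j q b"
proof (induction k arbitrary: i j)
  case 0
  then show ?case by (auto simp: starts_def)
next
  case (Suc k)
  from Suc.prems show ?case
  proof (cases rule: net_Suc_cases)
    case (echo q' b')
    then show ?thesis using Suc.IH sval_count_origin[of k j q b] by (auto simp: pending_def)
  next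
    case (coin V r)
    have V: "viewed j r V" using coin by (auto simp: viewed_def)
    have "c r \<notin> V"
    proof
      assume "c r \<in> V"
      with coin(6,7) show False by (cases "c r"; auto; metis (full_types))
    qed
    then show ?thesis
      using V coin viewed_rnd[OF V] by (auto simp: starts_def)
  qed (use Suc.IH in auto)
qed

lemma flag_starts: "flag t (state k i) q b \<Longrightarrow> \<exists>j. starts j q b"
  using sval_count_origin[of k i q b] sval_starts by (fastforce simp: flag_def)

text \<open>Because of the threshold \<open>t + 1\<close> on echoes, the flag of an instance that no non-faulty
  process starts stays false for ever.\<close>
definition locked :: "bool \<Rightarrow> nat \<Rightarrow> bool" where
  "locked b r \<longleftrightarrow> (\<forall>j. \<not> starts j (ptrs c r (\<not> b)) (\<not> b))"

lemma locked_viewed: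
  assumes "locked b r" "viewed i r V"
  shows "V = {b}"
proof -
  have "(\<not> b) \<notin> V"
    using viewed_flag[OF assms(2)] flag_starts assms(1) unfolding locked_def by blast
  then show ?thesis using viewed_nonempty[OF assms(2)] by (cases b; auto; metis (full_types))
qed

text \<open>In round \<open>r + 1\<close> the pointer of the value opposite to the coin refers to a
  fresh instance, and only a process whose view lacks the coin would start it.\<close>

lemma locked_coin:
  assumes "1 \<le> r" "\<And>i V. viewed i r V \<Longrightarrow> c r \<in> V"
  shows "locked (c r) (Suc r)"
  using assms by (auto simp: locked_def starts_def)

text \<open>If the coin is \<open>b\<close>, all views are \<open>{b}\<close> and the fresh instance
  of the opposite value has no starter. If it is not, the pointer of the opposite value stays where
  it was.\<close>

lemma locked_Suc:
  assumes "locked b r" "1 \<le> r"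
  shows "locked b (Suc r)"
proof (cases "c r = b")
  case True
  then show ?thesis using locked_coin[OF assms(2)] locked_viewed[OF assms(1)] by auto
next
  case False
  then have "c r = (\<not> b)" by auto
  then show ?thesis using assms by (simp add: locked_def)
qed

lemma locked_mono: "r \<le> r' \<Longrightarrow> locked b r \<Longrightarrow> 1 \<le> r \<Longrightarrow> locked b r'"
  by (induction r' rule: dec_induct) (auto intro: locked_Suc)

section \<open>Intersecting quorums, decisions, agreement and validity\<close>

lemma card_Int_senders:
  assumes "A \<subseteq> {..<n}" "B \<subseteq> {..<n}" "n + m \<le> card A + card B"
  shows "m \<le> card (A \<inter> B)"
proof -
  have fin: "finite A" "finite B" using assms(1,2) by (auto intro: finite_subset)
  have "card (A \<union> B) \<le> n" using card_mono[of "{..<n}" "A \<union> B"] assms(1,2) by simp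
  then show ?thesis using card_Un_Int[OF fin] assms(3) by simp
qed

text \<open>Two quorums share at least \<open>2 * (n - t) - n > t\<close> senders, hence a
  non-faulty one, and that process sent the same \<open>AUX\<close> value to both receivers.\<close>

lemma singleton_view_common:
  assumes "viewed i r {w}" "viewed j r V"
  shows "w \<in> V"
proof -
  obtain k Q where Q: "quorum k i r Q" "{w} = snd ` Q" using viewed_quorum[OF assms(1)] by blast
  obtain k' Q' where Q': "quorum k' j r Q'" "V = snd ` Q'" using viewed_quorum[OF assms(2)] by blast
  note s = quorum_senders[OF Q(1)] and s' = quorum_senders[OF Q'(1)]
  have "t + 1 \<le> card (fst ` Q \<inter> fst ` Q')"
    using s(1,2) s'(1,2) n_gt by (intro card_Int_senders) auto
  then obtain p where p: "p \<in> fst ` Q" "p \<in> fst ` Q'" "cor p"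
    using correct_in_large_set[of "fst ` Q \<inter> fst ` Q'"] s(1) by auto
  then obtain x y where "(p, x) \<in> Q" "(p, i, AUX r x) \<in> net (X k)"
    "(p, y) \<in> Q'" "(p, j, AUX r y) \<in> net (X k')"
    using s(3) s'(3) by blast
  moreover from this have "x = y" using aux_inj' by blast
  moreover have "snd (p, x) \<in> {w}" unfolding Q(2) using \<open>(p, x) \<in> Q\<close> by (rule imageI)
  moreover have "snd (p, y) \<in> V" unfolding Q'(2) using \<open>(p, y) \<in> Q'\<close> by (rule imageI)
  ultimately show ?thesis by simp
qed

text \<open>All members of \<open>S\<close> are non-faulty, having views, and \<open>t + 1\<close>
  of them cannot all be missing from a quorum of \<open>n - t\<close> senders. The common one sends
  the coin.\<close>

lemma supporters_view:
  assumes "\<And>p. p \<in> S \<Longrightarrow> \<exists>V. viewed p r V \<and> c r \<in> V" "t + 1 \<le> card S"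
    and "viewed i (Suc r) V"
  shows "c r \<in> V"
proof -
  obtain k Q where Q: "quorum k i (Suc r) Q" "V = snd ` Q" using viewed_quorum[OF assms(3)] by blast
  note s = quorum_senders[OF Q(1)]
  have S: "S \<subseteq> {..<n}" using assms(1) viewed_cor cor_less by blast
  have "1 \<le> card (fst ` Q \<inter> S)"
    using s(1,2) n_gt assms(2) by (intro card_Int_senders S) auto
  then have "fst ` Q \<inter> S \<noteq> {}" by auto
  then obtain p V' where p: "p \<in> fst ` Q" "cor p" "viewed p r V'" "c r \<in> V'"
    using assms(1) viewed_cor by blast
  then obtain w where "(p, w) \<in> Q" "(p, i, AUX (Suc r) w) \<in> net (X k)"
    using s(3) by blast
  moreover from this have "w = c r" using aux_value p by blast
  moreover have "snd (p, w) \<in> V" unfolding Q(2) using \<open>(p, w) \<in> Q\<close> by (rule imageI)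
  ultimately show ?thesis by simp
qed

text \<open>The first half serves agreement and validity. The second half serves termination: a view
  equal to the coin of its round forces a decision no later than that round.\<close>

lemma dec_inv:
  "(\<forall>b r. dec (state k i) = Some (b, r) \<longrightarrow> r < rnd (state k i) \<and> b = c r \<and> viewed i r {b}) \<and>
   (\<forall>r. r < rnd (state k i) \<and> viewed i r {c r} \<longrightarrow>
     (\<exists>b r'. dec (state k i) = Some (b, r') \<and> r' \<le> r))"
proof (induction k)
  case 0
  show ?case using viewed_rnd by (fastforce simp: init_st_def)
next
  case (Suc k)
  show ?case
  proof (cases rule: state_Suc_cases[of k i])
    case (coin V r)
    have V: "viewed i r V" using coin by (auto simp: viewed_def)
    have "\<exists>b r'. dec (state (Suc k) i) = Some (b, r') \<and> r' \<le> q"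
      if q: "q < rnd (state (Suc k) i)" "viewed i q {c q}" for q
    proof (cases "q < r")
      case True
      then show ?thesis using Suc q coin by auto
    next
      case False
      then have "q = r" using q coin by simp
      then have "V = {c r}" using viewed_unique[OF V] q by simp
      moreover have "r' < r" if "dec (state k i) = Some (b, r')" for b r'
        using that Suc coin by auto
      ultimately show ?thesis using coin \<open>q = r\<close>
        by (cases "dec (state k i)") (auto intro: less_imp_le)
    qed
    moreover have "r' < rnd (state (Suc k) i) \<and> b = c r' \<and> viewed i r' {b}"
      if "dec (state (Suc k) i) = Some (b, r')" for b r'
      using that coin Suc V by (auto split: if_splits)
    ultimately show ?thesis by blast
  qed (use Suc in auto)
qed

lemma decided_viewed:
  "dec (state k i) = Some (b, r) \<Longrightarrow> b = c r \<and> viewed i r {b} \<and> 1 \<le> r"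
  using dec_inv[of k i] viewed_rnd by blast

text \<open>Decisions of the same round equal its coin. Otherwise the earlier one comes from a
  singleton view, which puts the coin into every view of that round and locks the value from the
  next round on.\<close>

lemma agreement:
  assumes "dec (state k i) = Some (b, r)" "dec (state k' j) = Some (b', r')"
  shows "b = b'"
proof -
  have *: "b = b'" if "b = c r \<and> viewed i r {b} \<and> 1 \<le> r" "b' = c r' \<and> viewed j r' {b'} \<and> 1 \<le> r'"
    "r \<le> r'" for i j b b' r r'
  proof (cases "r = r'")
    case False
    have "locked b (Suc r)"
      using locked_coin[of r] singleton_view_common[of i r b] that by blast
    then have "locked b r'" using False that by (intro locked_mono[of "Suc r" r']) auto
    then show ?thesis using locked_viewed that by blast
  qed (use that in simp)
  show ?thesis
    using *[OF decided_viewed[OF assms(1)] decided_viewed[OF assms(2)]]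
      *[OF decided_viewed[OF assms(2)] decided_viewed[OF assms(1)]]
    by (cases "r \<le> r'") auto
qed

lemma validity:
  assumes "dec (state k i) = Some (b, r)"
  shows "\<exists>j. cor j \<and> v j = b"
proof (rule ccontr)
  assume "\<not> ?thesis"
  \<comment> \<open>Both pointers of round 1 refer to tag 1, and an instance with tag 1 is started
    by proposing its value only.\<close>
  then have "locked (\<not> b) 1" by (auto simp: locked_def starts_def)
  then have "locked (\<not> b) r" using locked_mono[of 1 r] decided_viewed[OF assms] by simp
  then show False using locked_viewed decided_viewed[OF assms] by blast
qed

end

subsection \<open>Liveness\<close>

text \<open>Finitely many events that persist once they occur all hold at the maximum of their
  times.\<close>

lemma common_time:
  assumes "finite S" "\<And>j. j \<in> S \<Longrightarrow> \<exists>k::nat. P j k" "\<And>j k k'. k \<le> k' \<Longrightarrow> P j k \<Longrightarrow> P j k'"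
  shows "\<exists>k. \<forall>j\<in>S. P j k"
  using assms(1,2)
proof (induction S)
  case (insert x S)
  obtain k where "\<forall>j\<in>S. P j k" using insert by auto
  moreover obtain k' where "P x k'" using insert.prems by blast
  ultimately have "\<forall>j\<in>insert x S. P j (max k k')"
    using assms(3)[of k "max k k'"] assms(3)[of k' "max k k'"] by auto
  then show ?case ..
qed simp

text \<open>The waiting condition of the current phase: when it holds, the next local step is bound
  to advance the process.\<close>

definition enabled :: "nat \<Rightarrow> nat \<Rightarrow> nat set \<Rightarrow> config \<Rightarrow> lstate \<Rightarrow> bool" where
  "enabled n t F cfg s = (case ph s of
      W3 \<Rightarrow> ptrflag t s False \<or> ptrflag t s True
    | W6 \<Rightarrow> \<exists>Q. valid_view n t s Q
    | WCoin V \<Rightarrow> coin_ready n t F cfg (rnd s))"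

lemma prog_main_step:
  "enabled n t F cfg s \<Longrightarrow> prog (fst (main_step n t F c i Q cfg s N)) = Suc (prog s)"
  by (auto simp: enabled_def main_step_def prog_def Let_def split: phase.splits)

lemma prog_local_step:
  assumes "enabled n t F cfg (procs cfg i)"
  shows "prog (procs (local_step n t F c i Q cfg) i) = Suc (prog (procs cfg i))"
proof -
  define s1 where "s1 = (procs cfg i)\<lparr>bcast := bcast (procs cfg i) \<union> pending t (procs cfg i)\<rparr>"
  have pf: "ptrflag t s1 b = ptrflag t (procs cfg i) b" for b
    by (simp add: s1_def ptrflag_def flag_def sval_count_def)
  have vv: "valid_view n t s1 Q = valid_view n t (procs cfg i) Q" for Q
    unfolding valid_view_def pf by (simp add: s1_def)
  have "ph s1 = ph (procs cfg i)" "rnd s1 = rnd (procs cfg i)" by (simp_all add: s1_def)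
  then have "enabled n t F cfg s1"
    using assms by (simp only: enabled_def pf vv)
  note prog_main_step[OF this]
  then show ?thesis
    by (simp add: local_step_def Let_def case_prod_beta s1_def prog_def)
qed

lemma echo_local_step:
  assumes "(q, b) \<in> pending t (procs cfg i)" "j < n"
  shows "(i, j, SVAL q b) \<in> net (local_step n t F c i Q cfg)"
proof -
  have "N \<subseteq> snd (main_step n t F c i Q cfg s N)" for s N
    by (auto simp: main_step_def Let_def split: phase.split)
  then show ?thesis
    using assms by (force simp: local_step_def Let_def case_prod_beta)
qed

section \<open>Messages that a process has sent by a given point\<close>

context run
begin

lemma bcast_sent:
  "(q, b) \<in> bcast (state k i) \<Longrightarrow> cor i \<Longrightarrow> j < n \<Longrightarrow> (i, j, SVAL q b) \<in> net (X k)"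
proof (induction k)
  case 0
  then show ?case by (simp add: init_st_def)
next
  case (Suc k)
  have mono: "(i, j, SVAL q b) \<in> net (X k) \<Longrightarrow> (i, j, SVAL q b) \<in> net (X (Suc k))"
    using net_Suc[of k] by blast
  show ?case
    by (cases rule: state_Suc_cases[of k i]) (use Suc mono in \<open>auto simp: bc_def split: if_splits\<close>)
qed

lemma aux_sent:
  assumes "cor i" "1 \<le> r" "3 * r + 1 \<le> prog (state k i)"
  shows "\<exists>w. \<forall>j<n. (i, j, AUX r w) \<in> net (X k)"
  using assms(3)
proof (induction k)
  case 0
  then show ?case using assms(2) by (simp add: prog_def init_st_def)
next
  case (Suc k)
  show ?case
  proof (cases "3 * r + 1 \<le> prog (state k i)")
    case True
    then show ?thesis using Suc.IH net_Suc[of k] by blast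
  next
    case False
    show ?thesis
    proof (cases rule: state_Suc_cases[of k i])
      case (w3 w)
      then have "prog (state k i) = 3 * rnd (state k i)" "prog (state (Suc k) i) = 3 * rnd (state k i) + 1"
        by (simp_all add: prog_def)
      then have "rnd (state k i) = r" using False Suc.prems by simp
      then have "\<forall>j<n. (i, j, AUX r w) \<in> net (X (Suc k))" using w3(6) by (simp add: bc_def)
      then show ?thesis ..
    next
      case (w6 Q)
      then have "prog (state k i) = 3 * rnd (state k i) + 1" "prog (state (Suc k) i) = 3 * rnd (state k i) + 2"
        by (simp_all add: prog_def)
      then show ?thesis using False Suc.prems by presburger
    next
      case (coin V r)
      then have "prog (state k i) = 3 * rnd (state k i) + 2" "prog (state (Suc k) i) = 3 * rnd (state k i) + 3"
        by (simp_all add: prog_def)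
      then show ?thesis using False Suc.prems by presburger
    qed (use False Suc.prems in \<open>simp_all add: prog_def\<close>)
  qed
qed

lemma starts_sent:
  assumes "starts i q b" "q \<le> rnd (state k i)" "j < n"
  shows "(i, j, SVAL q b) \<in> net (X k)"
proof (cases "q = 1 \<and> v i = b")
  case True
  then show ?thesis using assms net_mono[of 0 k] by (auto simp: starts_def)
next
  case False
  with assms(1) obtain r V where r: "1 \<le> r" "q = Suc r" "b = (\<not> c r)" "viewed i r V" "c r \<notin> V"
    by (auto simp: starts_def)
  show ?thesis
    using assms(2)
  proof (induction k)
    case 0
    then show ?case using r by (simp add: init_st_def)
  next
    case (Suc k)
    show ?case
    proof (cases "q \<le> rnd (state k i)")
      case True
      then show ?thesis using Suc.IH net_Suc[of k] by blast
    next
      case False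
      then show ?thesis
      proof (cases rule: state_Suc_cases[of k i])
        case (coin V' r')
        then have "r' = r" using False Suc.prems r by simp
        then have "viewed i r V'" using coin by (auto simp: viewed_def)
        then have "V' = V" using viewed_unique r by blast
        then have "\<not> (V' = {c r'} \<or> V' = {False, True})" using r \<open>r' = r\<close> by auto
        then show ?thesis using coin(6) r \<open>r' = r\<close> assms(3) by (simp add: bc_def)
      qed (use Suc.prems in auto)
    qed
  qed
qed

end

section \<open>S-Broadcast and progress under fair delivery and scheduling\<close>

locale fair_exec = run +
  assumes delivered: "cor j \<Longrightarrow> cor i \<Longrightarrow> (j, i, m) \<in> net (X k) \<Longrightarrow> \<exists>k. (j, m) \<in> rcvd (state k i)"
    and scheduled: "cor i \<Longrightarrow> \<exists>k'\<ge>k. \<exists>Q. a k' = Local i Q"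
begin

text \<open>The process need only be enabled, from time \<open>k0\<close> on, whenever it is still
  at position \<open>m\<close>: at its next scheduled step after \<open>k0\<close> it has either
  left \<open>m\<close> already or does so then.\<close>

lemma advance:
  assumes "cor i" "m \<le> prog (state k i)"
    and "\<And>k. k0 \<le> k \<Longrightarrow> prog (state k i) = m \<Longrightarrow> enabled n t F (X k) (state k i)"
  shows "\<exists>k. Suc m \<le> prog (state k i)"
proof -
  obtain k' Q where k': "max k k0 \<le> k'" "a k' = Local i Q" using scheduled[OF assms(1)] by blast
  show ?thesis
  proof (cases "prog (state k' i) = m")
    case True
    then have "enabled n t F (X k') (state k' i)" using assms(3) k' by simp
    then have "prog (state (Suc k') i) = Suc m"
      using prog_local_step True k' assms(1) by (simp add: X_Suc)
    then show ?thesis by (metis order_refl)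
  next
    case False
    then show ?thesis using prog_mono[of k k' i] assms(2) k' by (intro exI[of _ k']) simp
  qed
qed

lemma sval_received:
  assumes "cor i" "S \<subseteq> {j. cor j}" "\<And>j. j \<in> S \<Longrightarrow> \<exists>k. \<forall>i<n. (j, i, SVAL q b) \<in> net (X k)"
  shows "\<exists>k. card S \<le> sval_count (state k i) q b"
proof -
  have "\<exists>k. \<forall>j\<in>S. (j, SVAL q b) \<in> rcvd (state k i)"
  proof (rule common_time)
    show "finite S" using assms(2) finite_cor by (rule finite_subset)
    show "\<exists>k. (j, SVAL q b) \<in> rcvd (state k i)" if "j \<in> S" for j
      using delivered[of j i] assms that cor_less by blast
  qed (use rcvd_mono in blast)
  then obtain k where "S \<subseteq> {j. (j, SVAL q b) \<in> rcvd (state k i)}" by blast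
  then have "card S \<le> sval_count (state k i) q b"
    unfolding sval_count_def by (intro card_mono finite_svals)
  then show ?thesis ..
qed

text \<open>The messages of \<open>t + 1\<close> non-faulty senders reach everyone and trigger an
  echo by every non-faulty process; the resulting \<open>n - t\<close> messages meet the threshold
  \<open>2 * t + 1\<close>. Invocation is assumed because an instance reacts in the background only
  after being invoked.\<close>

lemma relay:
  assumes "S \<subseteq> {j. cor j}" "t + 1 \<le> card S"
    and "\<And>j. j \<in> S \<Longrightarrow> \<exists>k. \<forall>i<n. (j, i, SVAL q b) \<in> net (X k)"
    and inv: "\<And>i. cor i \<Longrightarrow> \<exists>k. (q, b) \<in> invoked (state k i)"
    and "cor i"
  shows "\<exists>k. flag t (state k i) q b"
proof -
  have "\<exists>k. \<forall>i<n. (j, i, SVAL q b) \<in> net (X k)" if j: "cor j" for j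
  proof -
    obtain k1 where k1: "t + 1 \<le> sval_count (state k1 j) q b"
      using sval_received[OF j assms(1,3)] assms(2) order_trans by blast
    obtain k2 where k2: "(q, b) \<in> invoked (state k2 j)" using inv j by blast
    obtain k Q where k: "max k1 k2 \<le> k" "a k = Local j Q" using scheduled[OF j] by blast
    have 1: "(q, b) \<in> invoked (state k j)" using k2 invoked_mono[of k2 k j] k by auto
    have 2: "t + 1 \<le> sval_count (state k j) q b"
      using k1 sval_count_mono[of k1 k j q b] k by simp
    show ?thesis
    proof (cases "(q, b) \<in> bcast (state k j)")
      case True
      then show ?thesis using bcast_sent j by blast
    next
      case False
      then have "(q, b) \<in> pending t (state k j)" using 1 2 by (simp add: pending_def)
      then have "\<forall>i<n. (j, i, SVAL q b) \<in> net (X (Suc k))"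
        using echo_local_step k j by (simp add: X_Suc)
      then show ?thesis ..
    qed
  qed
  then obtain k1 where k1: "card {j. cor j} \<le> sval_count (state k1 i) q b"
    using sval_received[OF \<open>cor i\<close>, of "{j. cor j}"] by blast
  obtain k2 where k2: "(q, b) \<in> invoked (state k2 i)" using inv \<open>cor i\<close> by blast
  have "2 * t + 1 \<le> sval_count (state (max k1 k2) i) q b"
    using k1 sval_count_mono[of k1 "max k1 k2" i q b] card_cor n_gt by simp
  moreover have "(q, b) \<in> invoked (state (max k1 k2) i)"
    using k2 invoked_mono[of k2 "max k1 k2" i] by auto
  ultimately show ?thesis by (auto simp: flag_def)
qed

text \<open>Among the \<open>2 * t + 1\<close> senders behind a raised flag at least
  \<open>t + 1\<close> are non-faulty; they broadcast to everyone, so \<open>relay\<close>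
  applies.\<close>

lemma flag_totality:
  assumes "flag t (state k j) q b" "\<And>i. cor i \<Longrightarrow> \<exists>k. (q, b) \<in> invoked (state k i)" "cor i"
  shows "\<exists>k. flag t (state k i) q b"
proof -
  define R where "R = {i. (i, SVAL q b) \<in> rcvd (state k j)}"
  have "2 * t + 1 \<le> card R" using assms(1) by (simp add: R_def flag_def sval_count_def)
  moreover have "card R - card F \<le> card (R - F)" by (rule diff_card_le_card_Diff[OF finite_F])
  ultimately have card: "t + 1 \<le> card (R - F)" using card_F by simp
  have net: "(i, j, SVAL q b) \<in> net (X k)" if "i \<in> R - F" for i
    using that rcvd_origin by (auto simp: R_def)
  have cor: "R - F \<subseteq> {i. cor i}" using net_broadcast net by blast
  have "\<exists>k. \<forall>j<n. (i, j, SVAL q b) \<in> net (X k)" if "i \<in> R - F" for i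
    using net[OF that] net_broadcast by blast
  then show ?thesis using relay[OF cor card _ assms(2,3)] by blast
qed

section \<open>Completion of one round by all non-faulty processes\<close>

context
  fixes r :: nat
  assumes r_pos: "1 \<le> r"
    and reached: "\<And>i. cor i \<Longrightarrow> \<exists>k. 3 * r \<le> prog (state k i)"
begin

lemma ptr_invoked: "cor i \<Longrightarrow> \<exists>k. (ptrs c r b, b) \<in> invoked (state k i)"
proof -
  assume "cor i"
  then obtain k where "3 * r \<le> prog (state k i)" using reached by blast
  then have "r \<le> rnd (state k i)" using rnd_prog(2)[of "state k i"] by simp
  then have "(ptrs c r b, b) \<in> insts c (rnd (state k i))"
    using ptrs_in_insts[OF r_pos] insts_mono by blast
  then show ?thesis using state_inv by metis
qed

text \<open>This rules out blocking at step (3). In round 1 one of the two values has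
  \<open>t + 1\<close> non-faulty proposers. Later, if some view of the previous round contains the
  coin, the flag of that value is up and its pointer persists, so totality spreads it; if none does,
  all non-faulty processes start the fresh instance of the other value.\<close>

lemma some_flag: "\<exists>b. \<forall>i. cor i \<longrightarrow> (\<exists>k. flag t (state k i) (ptrs c r b) b)"
proof (cases "r = 1")
  case True
  define S where "S b = {j. cor j \<and> v j = b}" for b
  have "{j. cor j} = S True \<union> S False" by (auto simp: S_def)
  then have "card {j. cor j} \<le> card (S True) + card (S False)" by (metis card_Un_le)
  then have "t + 1 \<le> card (S True) \<or> t + 1 \<le> card (S False)" using card_cor n_gt by linarith
  then obtain b where b: "t + 1 \<le> card (S b)" by blast
  have "\<exists>k. \<forall>i<n. (j, i, SVAL (ptrs c r b) b) \<in> net (X k)" if "j \<in> S b" for j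
    using that True by (intro exI[of _ 0]) (auto simp: S_def)
  moreover have "S b \<subseteq> {j. cor j}" by (auto simp: S_def)
  ultimately have "\<exists>k. flag t (state k i) (ptrs c r b) b" if "cor i" for i
    using relay[OF _ b _ ptr_invoked that] by blast
  then show ?thesis by blast
next
  case False
  then obtain q where q: "r = Suc q" "1 \<le> q" using r_pos by (cases r) auto
  have viewed: "\<exists>V. viewed i q V" if i: "cor i" for i
  proof -
    obtain k where "3 * r \<le> prog (state k i)" using reached i by blast
    then show ?thesis using viewed_exists[of q k i] q by simp
  qed
  show ?thesis
  proof (cases "\<exists>i V. viewed i q V \<and> c q \<in> V")
    case True
    then obtain i k where "flag t (state k i) (ptrs c q (c q)) (c q)" using viewed_flag by blast
    then have "flag t (state k i) (ptrs c r (c q)) (c q)" using q by simp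
    then have "\<exists>k. flag t (state k j) (ptrs c r (c q)) (c q)" if "cor j" for j
      using flag_totality ptr_invoked that by blast
    then show ?thesis by blast
  next
    case False
    have r: "ptrs c r (\<not> c q) = r" using q by simp
    have "\<exists>k. \<forall>i<n. (j, i, SVAL r (\<not> c q)) \<in> net (X k)" if j: "cor j" for j
    proof -
      have "starts j r (\<not> c q)" using viewed[OF j] False q j by (auto simp: starts_def)
      moreover obtain k where "3 * r \<le> prog (state k j)" using reached j by blast
      then have "r \<le> rnd (state k j)" using rnd_prog(2)[of "state k j"] by simp
      ultimately show ?thesis using starts_sent by blast
    qed
    then have "\<exists>k. flag t (state k i) (ptrs c r (\<not> c q)) (\<not> c q)" if "cor i" for i
      using relay[of "{j. cor j}" r "\<not> c q" i] card_cor n_gt ptr_invoked[of _ "\<not> c q"] that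
      unfolding r by auto
    then show ?thesis by blast
  qed
qed

lemma aux_phase: "cor i \<Longrightarrow> \<exists>k. 3 * r + 1 \<le> prog (state k i)"
proof -
  assume i: "cor i"
  obtain k b k0 where k: "3 * r \<le> prog (state k i)" and k0: "flag t (state k0 i) (ptrs c r b) b"
    using some_flag reached i by blast
  have "\<exists>k. Suc (3 * r) \<le> prog (state k i)"
  proof (rule advance[OF i k])
    fix k assume "k0 \<le> k" and p: "prog (state k i) = 3 * r"
    then have "flag t (state k i) (ptrs c r b) b" using k0 flag_mono by blast
    moreover have "rnd (state k i) = r" "ph (state k i) = W3"
      using p by (auto simp: prog_def split: phase.splits; presburger)+
    ultimately have "ptrflag t (state k i) b"
      using state_inv[of k i] by (simp add: ptrflag_def)
    then show "enabled n t F (X k) (state k i)"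
      using \<open>ph (state k i) = W3\<close> by (cases b) (auto simp: enabled_def)
  qed
  then show ?thesis by simp
qed

lemma coin_phase: "cor i \<Longrightarrow> \<exists>k. 3 * r + 2 \<le> prog (state k i)"
proof -
  assume i: "cor i"
  have "\<exists>w. (\<exists>k. (j, AUX r w) \<in> rcvd (state k i)) \<and> (\<exists>k. flag t (state k i) (ptrs c r w) w)"
    if j: "cor j" for j
  proof -
    obtain k w where kw: "(j, i, AUX r w) \<in> net (X k)"
      using aux_phase[OF j] aux_sent[OF j r_pos] cor_less[OF i] by meson
    moreover have "\<exists>k. flag t (state k i) (ptrs c r w) w"
      using aux_value[OF kw] flag_totality ptr_invoked i by blast
    ultimately show ?thesis using delivered[OF j i] by blast
  qed
  then obtain w where w: "\<And>j. cor j \<Longrightarrow> \<exists>k. (j, AUX r (w j)) \<in> rcvd (state k i)"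
    "\<And>j. cor j \<Longrightarrow> \<exists>k. flag t (state k i) (ptrs c r (w j)) (w j)" by metis
  have "\<exists>k. \<forall>j\<in>{j. cor j}. (j, AUX r (w j)) \<in> rcvd (state k i)"
    by (rule common_time[OF finite_cor]) (use w(1) rcvd_mono in blast)+
  then obtain k1 where k1: "\<And>j. cor j \<Longrightarrow> (j, AUX r (w j)) \<in> rcvd (state k1 i)" by blast
  have "\<exists>k. \<forall>j\<in>{j. cor j}. flag t (state k i) (ptrs c r (w j)) (w j)"
    by (rule common_time[OF finite_cor]) (use w(2) flag_mono in blast)+
  then obtain k2 where k2: "\<And>j. cor j \<Longrightarrow> flag t (state k2 i) (ptrs c r (w j)) (w j)" by blast
  \<comment> \<open>There may be more than \<open>n - t\<close> non-faulty processes, whereas a view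
    uses exactly \<open>n - t\<close> messages.\<close>
  obtain T where T: "T \<subseteq> {j. cor j}" "card T = n - t" "finite T"
    using obtain_subset_with_card_n[OF card_cor] by blast
  define Q where "Q = (\<lambda>j. (j, w j)) ` T"
  obtain k where k: "3 * r + 1 \<le> prog (state k i)" using aux_phase i by blast
  have "\<exists>k. Suc (3 * r + 1) \<le> prog (state k i)"
  proof (rule advance[OF i k])
    fix k assume k: "max k1 k2 \<le> k" and p: "prog (state k i) = 3 * r + 1"
    have ph: "rnd (state k i) = r" "ph (state k i) = W6"
      using p by (auto simp: prog_def split: phase.splits; presburger)+
    have "(j, AUX r (w j)) \<in> rcvd (state k i)" if "cor j" for j
      using k1[OF that] rcvd_mono[of k1 k i] k by auto
    moreover have "flag t (state k i) (ptrs c r (w j)) (w j)" if "cor j" for j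
      using k2[OF that] flag_mono[of k2 k i] k by auto
    moreover have "card Q = n - t" unfolding Q_def using T by (simp add: card_image inj_on_def)
    ultimately have "valid_view n t (state k i) Q"
      using T ph state_inv[of k i]
      by (auto simp: valid_view_def Q_def inj_on_def ptrflag_def)
    then show "enabled n t F (X k) (state k i)"
      using ph by (auto simp: enabled_def)
  qed
  then show ?thesis by simp
qed

lemma coin_ready_eventually: "\<exists>k. \<forall>k'\<ge>k. coin_ready n t F (X k') r"
proof -
  have "\<exists>k. \<forall>j\<in>{j. cor j}. 3 * r + 2 \<le> prog (state k j)"
    by (rule common_time[OF finite_cor]) (use coin_phase prog_mono order_trans in blast)+
  then obtain k where k: "\<And>j. cor j \<Longrightarrow> 3 * r + 2 \<le> prog (state k j)" by blast
  have "coin_ready n t F (X k') r" if "k \<le> k'" for k'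
  proof -
    have "{j. cor j \<and> called (state k' j) r} = {j. cor j}"
      using k prog_mono[OF that] order_trans by (fastforce simp: called_iff_prog)
    then show ?thesis using card_cor n_gt by (simp add: coin_ready_def)
  qed
  then show ?thesis by blast
qed

lemma next_round: "cor i \<Longrightarrow> \<exists>k. 3 * Suc r \<le> prog (state k i)"
proof -
  assume i: "cor i"
  obtain k0 where k0: "\<And>k. k0 \<le> k \<Longrightarrow> coin_ready n t F (X k) r"
    using coin_ready_eventually by blast
  obtain k where k: "3 * r + 2 \<le> prog (state k i)" using coin_phase i by blast
  have Suc_r: "3 * Suc r = Suc (3 * r + 2)" by simp
  show ?thesis
    unfolding Suc_r
  proof (rule advance[OF i k])
    fix k assume k: "k0 \<le> k" and p: "prog (state k i) = 3 * r + 2"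
    obtain V where "rnd (state k i) = r" "ph (state k i) = WCoin V"
      using p by (auto simp: prog_def split: phase.splits; presburger)
    then show "enabled n t F (X k) (state k i)"
      using k0[OF k] by (simp add: enabled_def)
  qed
qed

end

lemma rounds_reached: "1 \<le> r \<Longrightarrow> cor i \<Longrightarrow> \<exists>k. 3 * r \<le> prog (state k i)"
proof (induction r arbitrary: i rule: dec_induct)
  case base
  then show ?case by (auto simp: prog_def init_st_def intro!: exI[of _ 0])
next
  case (step r)
  then show ?case by (intro next_round) auto
qed

lemma progress: "cor i \<Longrightarrow> \<exists>k. r < rnd (state k i)"
proof -
  assume "cor i"
  then obtain k where "3 * Suc r \<le> prog (state k i)" using rounds_reached[of "Suc r" i] by auto
  then have "r < rnd (state k i)" using rnd_prog(2)[of "state k i"] by simp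
  then show ?thesis ..
qed

end

text \<open>The bit that the coin of round \<open>r\<close> should show: the value of a singleton view computed
  before that coin is revealed. If there is none, both values do, since then \<open>t + 1\<close>
  non-faulty processes hold the view \<open>{0, 1}\<close>.\<close>
definition coin_guess :: "nat \<Rightarrow> nat \<Rightarrow> nat set \<Rightarrow> (nat \<Rightarrow> config) \<Rightarrow> nat \<Rightarrow> bool" where
  "coin_guess n t F X r \<longleftrightarrow> (\<exists>k i. coin_ready n t F (X k) r \<and> (\<forall>k'<k. \<not> coin_ready n t F (X k') r) \<and>
     correct n F i \<and> rnd (procs (X k) i) = r \<and> ph (procs (X k) i) = WCoin {True})"

section \<open>Effect of a favourable triple of coins\<close>

context run
begin

text \<open>Leaving a round requires its coin to be ready strictly earlier. Hence at the first time
  that the coin of round \<open>r\<close> is ready, every caller is still in round \<open>r\<close>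
  and holds its view.\<close>

lemma round_left:
  "1 \<le> r \<Longrightarrow> r < rnd (state k i) \<Longrightarrow> \<exists>k'<k. coin_ready n t F (X k') r"
proof (induction k)
  case 0
  then show ?case by (simp add: init_st_def)
next
  case (Suc k)
  show ?case
  proof (cases "r < rnd (state k i)")
    case True
    then show ?thesis using Suc less_SucI by blast
  next
    case False
    then show ?thesis
      by (cases rule: state_Suc_cases[of k i]) (use Suc.prems in \<open>auto simp: less_Suc_eq\<close>)
  qed
qed

lemma good_guess_view:
  assumes "1 \<le> r" "coin_ready n t F (X k) r" "c r = coin_guess n t F X r" "viewed j (Suc r) V"
  shows "c r \<in> V"
proof -
  define k0 where "k0 = (LEAST k. coin_ready n t F (X k) r)"
  have k0: "coin_ready n t F (X k0) r" "\<And>k'. k' < k0 \<Longrightarrow> \<not> coin_ready n t F (X k') r"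
    unfolding k0_def using assms(2) by (auto intro: LeastI dest: not_less_Least)
  have k0_unique: "k = k0" if "coin_ready n t F (X k) r" "\<forall>k'<k. \<not> coin_ready n t F (X k') r" for k
    using that k0 by (metis nat_neq_iff)
  define S where "S = {i. cor i \<and> called (state k0 i) r}"
  have S: "t + 1 \<le> card S" using k0(1) by (simp add: coin_ready_def S_def)
  have S_view: "\<exists>V. rnd (state k0 i) = r \<and> ph (state k0 i) = WCoin V" if "i \<in> S" for i
    using that round_left[OF assms(1), of k0 i] k0(2) by (auto simp: S_def called_def)
  have guess: "coin_guess n t F X r \<longleftrightarrow> (\<exists>i. cor i \<and> rnd (state k0 i) = r \<and> ph (state k0 i) = WCoin {True})"
    unfolding coin_guess_def using k0 k0_unique by blast
  show ?thesis
  \<comment> \<open>The singleton may be formed at any time, not only at \<open>k0\<close>: it locks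
    the coin as soon as it agrees with it.\<close>
  proof (cases "\<exists>i. viewed i r {c r}")
    case True
    then have "locked (c r) (Suc r)"
      using singleton_view_common by (intro locked_coin[OF assms(1)]) blast
    then show ?thesis using locked_viewed assms(4) by blast
  next
    case False
    have "c r \<in> U" if p: "p \<in> S" "rnd (state k0 p) = r" "ph (state k0 p) = WCoin U" for p U
    proof (rule ccontr)
      assume "c r \<notin> U"
      moreover have v: "viewed p r U" using p by (auto simp: viewed_def)
      ultimately have U: "U = {\<not> c r}"
        using viewed_nonempty[OF v] by (cases "c r"; auto; metis (full_types))
      \<comment> \<open>\<open>coin_guess\<close> is true only if some view \<open>{True}\<close>
        exists at \<open>k0\<close>. So a true coin yields a singleton equal to the coin, which is
        excluded, while a false coin means that nobody, in particular not \<open>p\<close>, has the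
        view \<open>{True}\<close> at \<open>k0\<close>.\<close>
      show False
      proof (cases "c r")
        case True
        then show False using guess assms(3) False by (auto simp: viewed_def)
      next
        case F: False
        then show False using guess assms(3) p U by (auto simp: S_def)
      qed
    qed
    then have "\<exists>U. viewed p r U \<and> c r \<in> U" if "p \<in> S" for p
      using S_view[OF that] that by (auto simp: viewed_def)
    then show ?thesis using supporters_view S assms(4) by blast
  qed
qed

text \<open>The coin of round \<open>r\<close> matches the guess and so lies in every view of round
  \<open>r + 1\<close>; the equal coin of round \<open>r + 1\<close> then locks it; the equal coin
  of round \<open>r + 2\<close> meets the singleton view and causes the decision.\<close>

lemma good_coins_decide:
  assumes "1 \<le> r" "c r = coin_guess n t F X r" "c (r + 1) = c r" "c (r + 2) = c r"
    and "cor i" "r + 2 < rnd (state k i)"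
  shows "\<exists>b r'. dec (state k i) = Some (b, r') \<and> r' \<le> r + 2"
proof -
  obtain k' where "coin_ready n t F (X k') r"
    using round_left[OF assms(1), of k i] assms(6) by auto
  then have "c (Suc r) \<in> V" if "viewed j (Suc r) V" for j V
    using good_guess_view[OF assms(1) _ assms(2) that] assms(3) by simp
  then have locked: "locked (c (Suc r)) (Suc (Suc r))"
    by (intro locked_coin) auto
  have "3 * (r + 2) + 2 \<le> prog (state k i)"
    using rnd_prog(1)[of "state k i"] assms(6) by simp
  then obtain V where V: "viewed i (r + 2) V" using viewed_exists by fastforce
  moreover have "V = {c (r + 2)}"
    using locked_viewed[OF locked, of i V] V assms(3,4) by simp
  ultimately show ?thesis using dec_inv[of k i] assms(6) by blast
qed

end

subsection \<open>Expected number of rounds\<close>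

lemma exec_0: "exec n t F v adv c 0 = init_cfg n F v"
  by (simp add: exec_def)

lemma exec_Suc: "exec n t F v adv c (Suc k) =
    step n t F c (act n t F v adv c k) (exec n t F v adv c k)"
  by (simp add: exec_def act_def Let_def)

lemma run_exec: "valid_system n t F \<Longrightarrow> run n t F v c (exec n t F v adv c) (act n t F v adv c)"
  by unfold_locales (simp_all add: exec_0 exec_Suc)

lemma fair_exec_exec:
  "valid_system n t F \<Longrightarrow> fair_run n t F v adv c \<Longrightarrow>
    fair_exec n t F v c (exec n t F v adv c) (act n t F v adv c)"
  using run_exec by (auto simp: fair_exec_def fair_exec_axioms_def fair_run_def)

lemma step_cong:
  assumes "\<And>r. coin_ready n t F cfg r \<Longrightarrow> c r = c' r"
  shows "step n t F c a cfg = step n t F c' a cfg"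
proof -
  have "main_step n t F c i Q cfg s N = main_step n t F c' i Q cfg s N" for i Q s N
    using assms by (auto simp: main_step_def Let_def split: phase.split)
  then show ?thesis by (cases a) (simp_all add: local_step_def)
qed

lemma coin_ready_antimono:
  assumes "coin_ready n t F cfg r'" "r \<le> r'"
  shows "coin_ready n t F cfg r"
proof -
  have "finite {j. correct n F j \<and> called (procs cfg j) r}"
    by (rule finite_subset[of _ "{..<n}"]) (auto simp: correct_def)
  then have "card {j. correct n F j \<and> called (procs cfg j) r'} \<le> card {j. correct n F j \<and> called (procs cfg j) r}"
    using assms(2) by (intro card_mono) (auto simp: called_iff_prog)
  then show ?thesis using assms(1) by (simp add: coin_ready_def)
qed

text \<open>This is unpredictability. Both a step and the adversary read only coins that are ready,
  and readiness of a coin implies readiness of all earlier ones; so until the coin of round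
  \<open>r\<close> is ready, the history is determined by the coins before \<open>r\<close>.\<close>

lemma hist_cong:
  assumes "\<And>j. j < r \<Longrightarrow> c j = c' j"
    and "\<And>k'. k' < k \<Longrightarrow> \<not> coin_ready n t F (exec n t F v adv c k') r"
  shows "hist n t F v adv c k = hist n t F v adv c' k"
  using assms(2)
proof (induction k)
  case (Suc k)
  then have IH: "hist n t F v adv c' k = hist n t F v adv c k" by simp
  define cfg where "cfg = hd (hist n t F v adv c k)"
  have eq: "c q = c' q" if "coin_ready n t F cfg q" for q
  proof (rule assms(1), rule ccontr)
    assume "\<not> q < r"
    then have "coin_ready n t F cfg r" using that coin_ready_antimono by (meson not_le)
    then show False using Suc.prems[of k] by (simp add: exec_def cfg_def)
  qed
  then have "revealed n t F cfg c = revealed n t F cfg c'"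
    by (auto simp: revealed_def fun_eq_iff)
  moreover have "step n t F c a cfg = step n t F c' a cfg" for a
    using eq by (rule step_cong)
  ultimately show ?case by (simp add: Let_def IH flip: cfg_def)
qed simp

lemma (in run) rnd_le: "rnd (state k i) \<le> Suc k"
proof (induction k)
  case 0
  then show ?case by (simp add: init_st_def)
next
  case (Suc k)
  then show ?case by (cases rule: state_Suc_cases[of k i]) auto
qed

lemma (in run) coin_ready_le:
  assumes "coin_ready n t F (X k) r"
  shows "r \<le> Suc k"
proof -
  have "card {j. cor j \<and> called (state k j) r} \<noteq> 0" using assms by (simp add: coin_ready_def)
  then obtain j where "called (state k j) r" by (metis (mono_tags, lifting) card.empty empty_Collect_eq)
  then have "r \<le> rnd (state k j)" by (auto simp: called_def)
  then show ?thesis using rnd_le order_trans by blast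
qed

text \<open>After \<open>k\<close> steps no round beyond \<open>k + 1\<close> has been reached, so
  only finitely many coins matter. This is the source of measurability.\<close>

lemma exec_cong:
  assumes "valid_system n t F" "\<And>j. j < k + 2 \<Longrightarrow> c j = c' j"
  shows "exec n t F v adv c k = exec n t F v adv c' k"
proof -
  interpret run n t F v c "exec n t F v adv c" "act n t F v adv c"
    using assms(1) by (rule run_exec)
  have "hist n t F v adv c k = hist n t F v adv c' k"
    by (rule hist_cong[where r = "k + 2"]) (use assms(2) coin_ready_le in fastforce)+
  then show ?thesis by (simp add: exec_def)
qed

text \<open>The guess looks only at the first configuration in which the coin is ready, which
  \<open>hist_cong\<close> still covers. It is thus fixed before the coin it is compared
  with.\<close>

lemma coin_guess_cong:
  assumes "\<And>j. j < r \<Longrightarrow> c j = c' j"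
  shows "coin_guess n t F (exec n t F v adv c) r = coin_guess n t F (exec n t F v adv c') r"
proof -
  have "coin_guess n t F (exec n t F v adv c2) r"
    if "coin_guess n t F (exec n t F v adv c1) r" and c: "\<And>j. j < r \<Longrightarrow> c1 j = c2 j" for c1 c2
  proof -
    from that(1) obtain k i where k: "coin_ready n t F (exec n t F v adv c1 k) r"
      "\<And>k'. k' < k \<Longrightarrow> \<not> coin_ready n t F (exec n t F v adv c1 k') r"
      "correct n F i" "rnd (procs (exec n t F v adv c1 k) i) = r"
      "ph (procs (exec n t F v adv c1 k) i) = WCoin {True}"
      by (auto simp: coin_guess_def)
    have "exec n t F v adv c1 k' = exec n t F v adv c2 k'" if "k' \<le> k" for k'
      using hist_cong[of r c1 c2 k' n t F v adv] c k(2) that by (simp add: exec_def)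
    then show ?thesis unfolding coin_guess_def using k by (metis less_imp_le order_refl)
  qed
  then show ?thesis using assms by metis
qed

section \<open>Events of the coin space and independence\<close>

abbreviation fair_coin :: "bool measure" where
  "fair_coin \<equiv> measure_pmf (bernoulli_pmf (1/2))"

interpretation coins: sequence_space fair_coin
  by unfold_locales

lemma space_coin_space [simp]: "space coin_space = UNIV"
  by (simp add: coin_space_def space_PiM PiE_def)

lemma cylinder:
  assumes "finite J"
  shows "{c. \<forall>j\<in>J. c j = x j} \<in> sets coin_space"
    and "emeasure coin_space {c. \<forall>j\<in>J. c j = x j} = ennreal ((1/2) ^ card J)"
proof -
  have emb: "{c. \<forall>j\<in>J. c j = x j} = prod_emb UNIV (\<lambda>_. fair_coin) J (Pi\<^sub>E J (\<lambda>j. {x j}))"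
    by (intro set_eqI) (simp add: prod_emb_iff PiE_iff)
  show "{c. \<forall>j\<in>J. c j = x j} \<in> sets coin_space"
    unfolding emb coin_space_def using assms by (intro sets_PiM_I) auto
  have "pmf (bernoulli_pmf (1/2)) b = 1/2" for b
    by (cases b) simp_all
  then have single: "emeasure fair_coin {b} = ennreal (1/2)" for b
    by (simp only: emeasure_pmf_single)
  have "emeasure coin_space {c. \<forall>j\<in>J. c j = x j} = (\<Prod>j\<in>J. emeasure fair_coin {x j})"
    unfolding emb coin_space_def using assms by (intro coins.emeasure_PiM_emb) auto
  also have "\<dots> = ennreal (1/2) ^ card J"
    by (simp only: single prod_constant)
  also have "\<dots> = ennreal ((1/2) ^ card J)"
    by (rule ennreal_power) simp
  finally show "emeasure coin_space {c. \<forall>j\<in>J. c j = x j} = ennreal ((1/2) ^ card J)" .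
qed

text \<open>Such an event is a finite union of cylinders, one for each admissible prefix of length
  \<open>N\<close>.\<close>

lemma finitely_determined_sets:
  assumes "\<And>c c'. (\<And>j. j < N \<Longrightarrow> c j = c' j) \<Longrightarrow> P c = P c'"
  shows "{c. P c} \<in> sets coin_space"
proof -
  define Z where "Z = (\<lambda>c. restrict c {..<N}) ` {c. P c}"
  have "Z \<subseteq> {..<N} \<rightarrow>\<^sub>E (UNIV :: bool set)" by (auto simp: Z_def)
  then have "finite Z" by (rule finite_subset) (auto intro: finite_PiE)
  have "{c. P c} = (\<Union>x\<in>Z. {c. \<forall>j\<in>{..<N}. c j = x j})"
  proof (intro equalityI subsetI)
    fix c assume "c \<in> (\<Union>x\<in>Z. {c. \<forall>j\<in>{..<N}. c j = x j})"
    then obtain c' where "P c'" "\<forall>j<N. c j = c' j" by (auto simp: Z_def)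
    then show "c \<in> {c. P c}" using assms[of c c'] by simp
  qed (auto simp: Z_def)
  also have "\<dots> \<in> sets coin_space"
    using \<open>finite Z\<close> cylinder(1) by (intro sets.finite_UN) auto
  finally show ?thesis .
qed

lemma emeasure_three_coins_miss:
  "emeasure coin_space {c. \<not> (c 0 = w \<and> c (Suc 0) = w \<and> c (Suc (Suc 0)) = w)} = ennreal (7/8)"
proof -
  define A where "A = {c::nat \<Rightarrow> bool. \<forall>j\<in>{0, Suc 0, Suc (Suc 0)}. c j = w}"
  have A: "A \<in> sets coin_space" "emeasure coin_space A = ennreal (1/8)"
    using cylinder[of "{0, Suc 0, Suc (Suc 0)}" "\<lambda>_. w"] by (simp_all add: A_def power3_eq_cube)
  have "{c. \<not> (c 0 = w \<and> c (Suc 0) = w \<and> c (Suc (Suc 0)) = w)} = space coin_space - A"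
    by (auto simp: A_def)
  also have "emeasure coin_space \<dots> = emeasure coin_space (space coin_space) - emeasure coin_space A"
    using A by (intro emeasure_compl) simp_all
  also have "\<dots> = ennreal 1 - ennreal (1/8)"
    using A coins.P.emeasure_space_1 by (simp add: coin_space_def)
  also have "\<dots> = ennreal (7/8)"
    by (subst ennreal_minus) simp_all
  finally show ?thesis .
qed

text \<open>Splitting a sequence at \<open>r\<close> turns the coin measure into a product of two
  copies. For a fixed prefix both \<open>B\<close> and \<open>W\<close> are constant, so the inner
  integral over the tail is \<open>7/8\<close> or 0.\<close>

lemma independent_triple:
  assumes B: "\<And>c c'. (\<And>j. j < r \<Longrightarrow> c j = c' j) \<Longrightarrow> B c = B c'"
    and W: "\<And>c c'. (\<And>j. j < r \<Longrightarrow> c j = c' j) \<Longrightarrow> W c = W c'"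
  shows "emeasure coin_space {c. B c \<and> \<not> (c r = W c \<and> c (r + 1) = c r \<and> c (r + 2) = c r)} =
    ennreal (7/8) * emeasure coin_space {c. B c}"
proof -
  define A where "A = {c. B c \<and> \<not> (c r = W c \<and> c (r + 1) = c r \<and> c (r + 2) = c r)}"
  have A: "A \<in> sets coin_space"
    unfolding A_def
  proof (rule finitely_determined_sets[where N = "r + 3"])
    fix c c' :: "nat \<Rightarrow> bool" assume "\<And>j. j < r + 3 \<Longrightarrow> c j = c' j"
    then show "(B c \<and> \<not> (c r = W c \<and> c (r + 1) = c r \<and> c (r + 2) = c r)) =
      (B c' \<and> \<not> (c' r = W c' \<and> c' (r + 1) = c' r \<and> c' (r + 2) = c' r))"
      using B[of c c'] W[of c c'] by simp
  qed
  have setB: "{c. B c} \<in> sets coin_space"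
    by (rule finitely_determined_sets[OF B])
  \<comment> \<open>\<open>comb_seq r x y\<close> takes its first \<open>r\<close> entries from
    \<open>x\<close> and continues with \<open>y\<close>, so coins \<open>r\<close>,
    \<open>r + 1\<close>, \<open>r + 2\<close> are the entries 0, 1, 2 of \<open>y\<close>.\<close>
  let ?f = "\<lambda>(x, y). comb_seq r x y :: nat \<Rightarrow> bool"
  have f: "?f \<in> measurable (coin_space \<Otimes>\<^sub>M coin_space) coin_space"
    unfolding coin_space_def by (rule measurable_comb_seq)
  have "emeasure coin_space A = emeasure (distr (coin_space \<Otimes>\<^sub>M coin_space) coin_space ?f) A"
    unfolding coin_space_def by (simp only: coins.PiM_comb_seq)
  also have "\<dots> = emeasure (coin_space \<Otimes>\<^sub>M coin_space) (?f -` A \<inter> space (coin_space \<Otimes>\<^sub>M coin_space))"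
    using f A by (rule emeasure_distr)
  also have "\<dots> = (\<integral>\<^sup>+ x. emeasure coin_space
      (Pair x -` (?f -` A \<inter> space (coin_space \<Otimes>\<^sub>M coin_space))) \<partial>coin_space)"
    using measurable_sets[OF f A] unfolding coin_space_def
    by (rule coins.P.emeasure_pair_measure_alt)
  also have "\<dots> = (\<integral>\<^sup>+ x. ennreal (7/8) * indicator {c. B c} x \<partial>coin_space)"
  proof (rule nn_integral_cong)
    fix x :: "nat \<Rightarrow> bool"
    have "B (comb_seq r x y) = B x" "W (comb_seq r x y) = W x" for y
      using B[of "comb_seq r x y" x] W[of "comb_seq r x y" x] by (simp_all add: comb_seq_less)
    moreover have "comb_seq r x y r = y 0" "comb_seq r x y (Suc r) = y (Suc 0)"
      "comb_seq r x y (Suc (Suc r)) = y (Suc (Suc 0))" for y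
      by (simp_all add: comb_seq_def Suc_diff_le)
    ultimately have "Pair x -` (?f -` A \<inter> space (coin_space \<Otimes>\<^sub>M coin_space)) =
      (if B x then {y. \<not> (y 0 = W x \<and> y (Suc 0) = W x \<and> y (Suc (Suc 0)) = W x)} else {})"
      by (auto simp: A_def space_pair_measure)
    then show "emeasure coin_space (Pair x -` (?f -` A \<inter> space (coin_space \<Otimes>\<^sub>M coin_space))) =
      ennreal (7/8) * indicator {c. B c} x"
      by (cases "B x") (simp_all only: if_True if_False emeasure_three_coins_miss, simp_all)
  qed
  also have "\<dots> = ennreal (7/8) * emeasure coin_space {c. B c}"
    using setB by (rule nn_integral_cmult_indicator)
  finally show ?thesis by (simp add: A_def)
qed

section \<open>Blocks of three rounds and the expected running time\<close>

definition good_block :: "nat \<Rightarrow> nat \<Rightarrow> nat set \<Rightarrow> (nat \<Rightarrow> bool) \<Rightarrow> adversary \<Rightarrow> nat \<Rightarrow> (nat \<Rightarrow> bool) \<Rightarrow> bool"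
  where "good_block n t F v adv m c \<longleftrightarrow> (let r = 3 * m + 1 in
    c r = coin_guess n t F (exec n t F v adv c) r \<and> c (r + 1) = c r \<and> c (r + 2) = c r)"

lemma good_block_cong:
  assumes "\<And>j. j < 3 * m + 4 \<Longrightarrow> c j = c' j"
  shows "good_block n t F v adv m c = good_block n t F v adv m c'"
  using assms coin_guess_cong[of "3 * m + 1" c c' n t F v adv]
  by (simp add: good_block_def Let_def)

lemma no_good_block_cong:
  assumes "\<And>j. j < 3 * m + 1 \<Longrightarrow> c j = c' j"
  shows "(\<forall>i<m. \<not> good_block n t F v adv i c) = (\<forall>i<m. \<not> good_block n t F v adv i c')"
  using assms good_block_cong[of _ c c' n t F v adv] by simp

lemma emeasure_no_good_block:
  "emeasure coin_space {c. \<forall>i<m. \<not> good_block n t F v adv i c} = ennreal ((7/8) ^ m)"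
proof (induction m)
  case 0
  have "emeasure coin_space (space coin_space) = 1"
    unfolding coin_space_def by (rule coins.P.emeasure_space_1)
  then show ?case by simp
next
  case (Suc m)
  define B where "B c = (\<forall>i<m. \<not> good_block n t F v adv i c)" for c
  define W where "W c = coin_guess n t F (exec n t F v adv c) (3 * m + 1)" for c
  have "(\<forall>i<Suc m. \<not> good_block n t F v adv i c) \<longleftrightarrow> B c \<and> \<not> good_block n t F v adv m c" for c
    by (auto simp: B_def less_Suc_eq)
  then have "{c. \<forall>i<Suc m. \<not> good_block n t F v adv i c} = {c. B c \<and>
      \<not> (c (3 * m + 1) = W c \<and> c (3 * m + 1 + 1) = c (3 * m + 1) \<and> c (3 * m + 1 + 2) = c (3 * m + 1))}"
    by (simp only: good_block_def Let_def W_def)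
  also have "emeasure coin_space \<dots> = ennreal (7/8) * emeasure coin_space {c. B c}"
    unfolding B_def W_def
    by (rule independent_triple) (rule no_good_block_cong coin_guess_cong; blast)+
  also have "\<dots> = ennreal (7/8) * ennreal ((7/8) ^ m)"
    using Suc by (simp only: B_def)
  also have "\<dots> = ennreal ((7/8) ^ Suc m)"
    by (subst ennreal_mult [symmetric]) simp_all
  finally show ?case .
qed

text \<open>The condition moves from the index set into the function, because measurability of an
  infimum is applied over a fixed countable index set.\<close>

lemma rounds_to_decide_alt:
  "rounds_to_decide n t F v adv c = (INF r. if \<exists>k. \<forall>i. correct n F i \<longrightarrow>
     (\<exists>a r'. dec (procs (exec n t F v adv c k) i) = Some (a, r') \<and> r' \<le> r) then of_nat r else \<infinity>)"
proof -
  have "(INF r\<in>{r. P r}. f r) = (INF r. if P r then f r else \<infinity>)" for P and f :: "nat \<Rightarrow> ennreal"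
  proof (rule antisym)
    show "(INF r. if P r then f r else \<infinity>) \<le> (INF r\<in>{r. P r}. f r)"
      by (rule INF_mono) auto
  qed (rule INF_greatest, simp add: INF_lower)
  then show ?thesis unfolding rounds_to_decide_def .
qed

lemma rounds_to_decide_measurable:
  assumes "valid_system n t F"
  shows "rounds_to_decide n t F v adv \<in> borel_measurable coin_space"
proof -
  have "{c. \<forall>i. correct n F i \<longrightarrow>
      (\<exists>a r'. dec (procs (exec n t F v adv c k) i) = Some (a, r') \<and> r' \<le> r)} \<in> sets coin_space" for k r
  proof (rule finitely_determined_sets[where N = "k + 2"])
    fix c c' :: "nat \<Rightarrow> bool" assume "\<And>j. j < k + 2 \<Longrightarrow> c j = c' j"
    then have "exec n t F v adv c k = exec n t F v adv c' k"
      by (rule exec_cong[OF assms])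
    then show "(\<forall>i. correct n F i \<longrightarrow>
        (\<exists>a r'. dec (procs (exec n t F v adv c k) i) = Some (a, r') \<and> r' \<le> r)) =
      (\<forall>i. correct n F i \<longrightarrow>
        (\<exists>a r'. dec (procs (exec n t F v adv c' k) i) = Some (a, r') \<and> r' \<le> r))" by simp
  qed
  then have "(\<Union>k. {c. \<forall>i. correct n F i \<longrightarrow>
      (\<exists>a r'. dec (procs (exec n t F v adv c k) i) = Some (a, r') \<and> r' \<le> r)}) \<in> sets coin_space" for r
    by blast
  moreover have "(\<Union>k. {c. P k c}) = {c. \<exists>k. P k c}" for P :: "nat \<Rightarrow> (nat \<Rightarrow> bool) \<Rightarrow> bool" by auto
  ultimately have [measurable]: "{c \<in> space coin_space. \<exists>k. \<forall>i. correct n F i \<longrightarrow>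
      (\<exists>a r'. dec (procs (exec n t F v adv c k) i) = Some (a, r') \<and> r' \<le> r)} \<in> sets coin_space" for r
    by simp
  show ?thesis
    unfolding rounds_to_decide_alt by measurable
qed

lemma good_block_rounds:
  assumes "valid_system n t F" "fair_run n t F v adv c" "good_block n t F v adv m c"
  shows "rounds_to_decide n t F v adv c \<le> of_nat (3 * m + 3)"
proof -
  interpret fair_exec n t F v c "exec n t F v adv c" "act n t F v adv c"
    using assms(1,2) by (rule fair_exec_exec)
  define r where "r = 3 * m + 1"
  have "\<exists>k. \<forall>i\<in>{i. cor i}. r + 2 < rnd (state k i)"
    by (rule common_time[OF finite_cor]) (use progress rnd_mono less_le_trans in blast)+
  then obtain k where "\<And>i. cor i \<Longrightarrow> r + 2 < rnd (state k i)" by blast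
  then have "\<exists>b r'. dec (state k i) = Some (b, r') \<and> r' \<le> r + 2" if "cor i" for i
    using good_coins_decide[of r i k] assms(3) that by (simp add: good_block_def r_def Let_def)
  then have "r + 2 \<in> {r. \<exists>k. \<forall>i. cor i \<longrightarrow> (\<exists>b r'. dec (state k i) = Some (b, r') \<and> r' \<le> r)}"
    by blast
  then have "rounds_to_decide n t F v adv c \<le> of_nat (r + 2)"
    unfolding rounds_to_decide_def by (rule INF_lower)
  moreover have "r + 2 = 3 * m + 3" by (simp add: r_def)
  ultimately show ?thesis by (simp only:)
qed

text \<open>Every block not preceded by a good one contributes three rounds. If block
  \<open>m\<close> is the first good one, the sum reaches \<open>3 * (m + 1)\<close>, the last round
  of that block; with no good block it is infinite.\<close>

lemma rounds_le_suminf: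
  assumes "valid_system n t F" "fair_run n t F v adv c"
  shows "rounds_to_decide n t F v adv c \<le>
    (\<Sum>m. 3 * indicator {c. \<forall>i<m. \<not> good_block n t F v adv i c} c)"
    (is "_ \<le> suminf ?f")
proof -
  have partial: "of_nat (3 * m + 3) \<le> suminf ?f" if none: "\<forall>i<m. \<not> good_block n t F v adv i c" for m
  proof -
    \<comment> \<open>Index \<open>m\<close> counts as well, since its indicator concerns only the
      blocks before \<open>m\<close>.\<close>
    have "?f i = 3" if "i < Suc m" for i
      using none that by simp
    then have "(\<Sum>i<Suc m. ?f i) = of_nat (3 * m + 3)" by (simp add: mult.commute)
    moreover have "(\<Sum>i<Suc m. ?f i) \<le> suminf ?f" by (rule sum_le_suminf) auto
    ultimately show ?thesis by simp
  qed
  show ?thesis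
  proof (cases "\<exists>m. good_block n t F v adv m c")
    case True
    define m where "m = (LEAST m. good_block n t F v adv m c)"
    have "good_block n t F v adv m c" "\<forall>i<m. \<not> good_block n t F v adv i c"
      unfolding m_def using True by (auto intro: LeastI_ex dest: not_less_Least)
    then show ?thesis using good_block_rounds[OF assms] partial order_trans by blast
  next
    case False
    have "suminf ?f = top"
    proof (rule ccontr)
      assume "suminf ?f \<noteq> top"
      then obtain m where "suminf ?f < of_nat m"
        using ennreal_Ex_less_of_nat by (auto simp: less_top)
      also have "(of_nat m :: ennreal) \<le> of_nat (3 * m + 3)" by (rule of_nat_mono) simp
      also have "\<dots> \<le> suminf ?f" using False by (intro partial) simp
      finally show False by simp
    qed
    then show ?thesis by simp
  qed
qed

lemma expected_rounds:
  assumes "valid_system n t F" "AE c in coin_space. fair_run n t F v adv c"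
  shows "(\<integral>\<^sup>+ c. rounds_to_decide n t F v adv c \<partial>coin_space) \<le> ennreal 24"
proof -
  let ?B = "\<lambda>m. {c. \<forall>i<m. \<not> good_block n t F v adv i c}"
  have B: "?B m \<in> sets coin_space" for m
    by (rule finitely_determined_sets[OF no_good_block_cong])
  have "(\<integral>\<^sup>+ c. rounds_to_decide n t F v adv c \<partial>coin_space) \<le>
      (\<integral>\<^sup>+ c. (\<Sum>m. 3 * indicator (?B m) c) \<partial>coin_space)"
    by (rule nn_integral_mono_AE, rule eventually_mono[OF assms(2)], rule rounds_le_suminf[OF assms(1)])
  also have "\<dots> = (\<Sum>m. \<integral>\<^sup>+ c. 3 * indicator (?B m) c \<partial>coin_space)"
    using B by (intro nn_integral_suminf) auto
  also have "\<dots> = (\<Sum>m. ennreal (3 * (7/8) ^ m))"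
    using B by (simp add: nn_integral_cmult_indicator emeasure_no_good_block ennreal_mult)
  also have "\<dots> = ennreal 24"
  proof (rule suminf_ennreal_eq)
    show "(\<lambda>m. 3 * (7/8) ^ m) sums (24::real)"
      using sums_mult[OF geometric_sums[of "7/8::real"], of 3] by simp
  qed simp
  finally show ?thesis by simp
qed

text \<open>A finite expectation makes the number of rounds finite almost surely, and a finite
  infimum has a nonempty index set, which supplies a time at which all have decided.\<close>

lemma almost_sure_decision:
  assumes "valid_system n t F" "AE c in coin_space. fair_run n t F v adv c"
  shows "AE c in coin_space. \<forall>i. correct n F i \<longrightarrow> (\<exists>k. dec (procs (exec n t F v adv c k) i) \<noteq> None)"
proof -
  have "(\<integral>\<^sup>+ c. rounds_to_decide n t F v adv c \<partial>coin_space) \<noteq> \<infinity>"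
    using expected_rounds[OF assms] by (auto simp: top_unique)
  then have "AE c in coin_space. rounds_to_decide n t F v adv c \<noteq> \<infinity>"
    by (rule nn_integral_PInf_AE[OF rounds_to_decide_measurable[OF assms(1)]])
  then show ?thesis
  proof (rule eventually_mono)
    fix c assume "rounds_to_decide n t F v adv c \<noteq> \<infinity>"
    then have "{r. \<exists>k. \<forall>i. correct n F i \<longrightarrow>
        (\<exists>a r'. dec (procs (exec n t F v adv c k) i) = Some (a, r') \<and> r' \<le> r)} \<noteq> {}"
      unfolding rounds_to_decide_def by (metis (no_types) INF_empty infinity_ennreal_def)
    then show "\<forall>i. correct n F i \<longrightarrow> (\<exists>k. dec (procs (exec n t F v adv c k) i) \<noteq> None)"
      by fastforce
  qed
qed

theorem theorem2:
  shows
   "(\<forall>n t F v adv c k k' i j a b ra rb.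
       valid_system n t F \<and> correct n F i \<and> correct n F j \<and>
       dec (procs (exec n t F v adv c k) i) = Some (a, ra) \<and>
       dec (procs (exec n t F v adv c k') j) = Some (b, rb) \<longrightarrow> a = b)
  \<and> (\<forall>n t F v adv c k i a ra a'.
       valid_system n t F \<and> correct n F i \<and>
       dec (procs (exec n t F v adv c k) i) = Some (a, ra) \<longrightarrow>
       (\<exists>j. correct n F j \<and> v j = a) \<and>
       ((\<forall>j. correct n F j \<longrightarrow> v j = a') \<longrightarrow> a = a'))
  \<and> (\<forall>n t F v adv c.
       valid_system n t F \<and> fair_run n t F v adv c \<longrightarrow>
       (\<forall>r i. correct n F i \<longrightarrow> (\<exists>k. r < rnd (procs (exec n t F v adv c k) i))))
  \<and> (\<forall>n t F v adv.
       valid_system n t F \<and> (AE c in coin_space. fair_run n t F v adv c) \<longrightarrow>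
       (AE c in coin_space. \<forall>i. correct n F i \<longrightarrow>
            (\<exists>k. dec (procs (exec n t F v adv c k) i) \<noteq> None)))
  \<and> (\<exists>C::real. \<forall>n t F v adv.
       valid_system n t F \<and> (AE c in coin_space. fair_run n t F v adv c) \<longrightarrow>
       rounds_to_decide n t F v adv \<in> borel_measurable coin_space \<and>
       (\<integral>\<^sup>+ c. rounds_to_decide n t F v adv c \<partial>coin_space) \<le> ennreal C)"
proof (intro conjI)
  show "\<forall>n t F v adv c k k' i j a b ra rb.
       valid_system n t F \<and> correct n F i \<and> correct n F j \<and>
       dec (procs (exec n t F v adv c k) i) = Some (a, ra) \<and>
       dec (procs (exec n t F v adv c k') j) = Some (b, rb) \<longrightarrow> a = b"
    using run.agreement[OF run_exec] by blast
  show "\<forall>n t F v adv c k i a ra a'.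
       valid_system n t F \<and> correct n F i \<and>
       dec (procs (exec n t F v adv c k) i) = Some (a, ra) \<longrightarrow>
       (\<exists>j. correct n F j \<and> v j = a) \<and>
       ((\<forall>j. correct n F j \<longrightarrow> v j = a') \<longrightarrow> a = a')"
    using run.validity[OF run_exec] by metis
  show "\<forall>n t F v adv c.
       valid_system n t F \<and> fair_run n t F v adv c \<longrightarrow>
       (\<forall>r i. correct n F i \<longrightarrow> (\<exists>k. r < rnd (procs (exec n t F v adv c k) i)))"
    using fair_exec.progress[OF fair_exec_exec] by blast
  show "\<forall>n t F v adv.
       valid_system n t F \<and> (AE c in coin_space. fair_run n t F v adv c) \<longrightarrow>
       (AE c in coin_space. \<forall>i. correct n F i \<longrightarrow>
            (\<exists>k. dec (procs (exec n t F v adv c k) i) \<noteq> None))"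
    using almost_sure_decision by blast
  show "\<exists>C::real. \<forall>n t F v adv.
       valid_system n t F \<and> (AE c in coin_space. fair_run n t F v adv c) \<longrightarrow>
       rounds_to_decide n t F v adv \<in> borel_measurable coin_space \<and>
       (\<integral>\<^sup>+ c. rounds_to_decide n t F v adv c \<partial>coin_space) \<le> ennreal C"
    using rounds_to_decide_measurable expected_rounds by (intro exI[of _ 24]) blast
qed

end
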